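(* For every real $\gamma$ with $0<\gamma<\frac{1}{2}$, there exists a constant $C(\gamma)$ such that for every real $X>3$, every prime $q$, and every integer $a$ coprime with $q$, one has $$ \left|E(X,q,a)\right| \leq C(\gamma)\left( \frac{X^{\frac13}(\log\log X)^{\frac73}}{(\log X)^{\frac16-\frac{\gamma}{3}}}+\frac{X(\log\log X)^2}{q(\log X)^{\frac{\gamma}{2}}}\right). $$
   Context: Let $\mu$ be the Möbius function, so $\mu^2$ is the indicator function of squarefree positive integers, and let $\varphi$ be Euler's totient function. For real $X>0$, an integer $q\geq 1$ and an integer $a$ coprime to $q$, define $$ E(X,q,a):=\sum_{\substack{n\leq X\\ n\equiv a \pmod q}}\mu^2(n)-\frac{1}{\varphi(q)}\sum_{\substack{n\leq X\\ (n,q)=1}}\mu^2(n), $$ where $n$ runs over positive integers. *)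

theory Defs
  imports Complex_Main "HOL-Number_Theory.Number_Theory" "HOL-Computational_Algebra.Squarefree"
begin

definition moebius_mu :: "nat \<Rightarrow> int" where
  "moebius_mu n = (if squarefree n then (-1) ^ card (prime_factors n) else 0)"

definition E :: "real \<Rightarrow> nat \<Rightarrow> int \<Rightarrow> real" where
  "E X q a =
     (\<Sum>n | 0 < n \<and> real n \<le> X \<and> [int n = a] (mod int q). real_of_int ((moebius_mu n)\<^sup>2))
     - 1 / real (totient q) *
       (\<Sum>n | 0 < n \<and> real n \<le> X \<and> coprime n q. real_of_int ((moebius_mu n)\<^sup>2))"

end

theory Submission
  imports Defs "HOL-Real_Asymp.Real_Asymp" "HOL-Analysis.Harmonic_Numbers"
begin

text \<open>
  Detect squarefreeness by \<open>\<mu>\<^sup>2(n) = \<Sum>d\<^sup>2|n. \<mu>(d)\<close>. With \<open>L = ln X\<close>, the \<open>d\<close> up to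
  \<open>D0 = X powr (1/3) * L powr (-1/6)\<close> contribute at most \<open>1\<close> each. For \<open>d\<close> beyond
  \<open>D1 = D0 * L powr (1/4)\<close> one fixes the cofactor \<open>m\<close> and uses that \<open>d\<^sup>2 * m \<equiv> a\<close> has at most two
  solutions modulo \<open>q\<close>. There remain the \<open>d\<close> between \<open>D0\<close> and \<open>D1\<close> for which \<open>d\<^sup>2 * m \<equiv> a\<close> has a small
  solution \<open>m\<close>. If such a \<open>d\<close> has a prime factor \<open>p\<close> between \<open>L powr (3/2)\<close> and \<open>X powr (1/24)\<close>, write
  \<open>d = p * e\<close>: for given \<open>e\<close> the residue class of \<open>m * p\<^sup>2\<close> modulo \<open>q\<close> is fixed, and for \<open>q > sqrt X\<close> this
  determines the integer \<open>m * p\<^sup>2\<close>, which leaves only \<open>O(L)\<close> choices of \<open>p\<close>. The \<open>d\<close> without such a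
  prime factor are sparse by a sieve bound. This gives an error
  \<open>O(X powr (1/3) * L powr (-1/6) + X / (q * L))\<close>, uniformly in \<open>\<gamma>\<close>.
\<close>

subsection \<open>Chebyshev-type bounds for primes\<close>

text \<open>Such a \<open>p\<close> divides the numerator \<open>fact (2 * m + 1)\<close> but
  neither \<open>fact m\<close> nor \<open>fact (Suc m)\<close>, so nothing in the denominator
  cancels it.\<close>

lemma prime_dvd_binomial:
  fixes p m :: nat
  assumes "prime p" "Suc m < p" "p \<le> 2 * m + 1"
  shows "p dvd ((2 * m + 1) choose m)"
proof -
  have "fact m * fact (Suc m) * ((2 * m + 1) choose m) = (fact (2 * m + 1) :: nat)"
    using binomial_fact_lemma[of m "2 * m + 1"] by (simp add: mult_2 del: fact_Suc)
  moreover have "p dvd fact (2 * m + 1)"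
    using assms by (subst prime_dvd_fact_iff) auto
  moreover have "\<not> p dvd fact m" "\<not> p dvd fact (Suc m)"
    using assms by (auto simp only: prime_dvd_fact_iff)
  ultimately show ?thesis
    using assms(1) by (metis prime_dvd_mult_iff)
qed

text \<open>The two middle entries of row \<open>2 * m + 1\<close> are equal, and together they are
  at most the row sum \<open>2 * 4 ^ m\<close>.\<close>

lemma choose_odd_middle_le: "((2 * m + 1) choose m) \<le> 4 ^ m"
proof -
  have "2 * ((2 * m + 1) choose m) = (\<Sum>k\<in>{m, Suc m}. (2 * m + 1) choose k)"
    using central_binomial_odd[of "2 * m + 1"] by simp
  also have "\<dots> \<le> (\<Sum>k\<le>2 * m + 1. (2 * m + 1) choose k)"
    by (rule sum_mono2) auto
  also have "\<dots> = 2 ^ (2 * m + 1)" by (rule choose_row_sum)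
  finally show ?thesis by (simp add: power_mult)
qed

lemma prod_primes_dvd:
  fixes n :: nat
  assumes "finite A" "\<And>p. p \<in> A \<Longrightarrow> prime p" "\<And>p. p \<in> A \<Longrightarrow> p dvd n"
  shows "\<Prod>A dvd n"
  using assms
proof (induction A rule: finite_induct)
  case (insert p A)
  have "coprime p (\<Prod>A)"
    using insert by (intro prod_coprime_right) (auto intro!: primes_coprime)
  with insert show ?case by (auto intro: divides_mult)
qed auto

text \<open>Erdos's induction. An even \<open>n > 2\<close> adds no prime to those up to
  \<open>n - 1\<close>. For \<open>n = 2 * m + 1\<close> the primes up to \<open>m + 1\<close> fall
  under the induction hypothesis, and the product of the later ones divides a middle binomial
  coefficient, which is at most \<open>4 ^ m\<close>.\<close>

lemma primorial_le: "\<Prod>{p. prime p \<and> p \<le> n} \<le> (4::nat) ^ n"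
proof (induction n rule: less_induct)
  case (less n)
  have fin: "finite {p. prime p \<and> p \<le> k}" for k :: nat
    by (rule finite_subset[of _ "{..k}"]) auto
  consider "n \<le> 2" | "n > 2" "even n" | m where "n = 2 * m + 1" "m \<ge> 1"
  proof (cases "even n")
    case True
    then show thesis using that(1,2) by (cases "n \<le> 2") auto
  next
    case False
    then obtain m where "n = 2 * m + 1" by (auto elim: oddE)
    then show thesis using that(1) that(3)[of m] by (cases "m = 0") auto
  qed
  then show ?case
  proof cases
    case 1
    then have "{p. prime p \<and> p \<le> n} = (if n = 2 then {2} else {})"
      by (auto dest: prime_ge_2_nat intro: order_antisym)
    then show ?thesis by (simp only:) simp
  next
    case 2
    then have "\<not> prime n" using prime_odd_nat by blast
    then have "prime p \<and> p \<le> n \<longleftrightarrow> prime p \<and> p \<le> n - 1" for p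
      by (cases "p = n") auto
    then have "\<Prod>{p. prime p \<and> p \<le> n} = \<Prod>{p. prime p \<and> p \<le> n - 1}" by (simp only:)
    also have "\<dots> \<le> 4 ^ (n - 1)" using less[of "n - 1"] 2 by simp
    also have "\<dots> \<le> 4 ^ n" by (rule power_increasing) auto
    finally show ?thesis .
  next
    case (3 m)
    let ?A = "{p. prime p \<and> p \<le> Suc m}" and ?B = "{p. prime p \<and> Suc m < p \<and> p \<le> 2 * m + 1}"
    have eq: "{p. prime p \<and> p \<le> n} = ?A \<union> ?B" using 3 by auto
    have finB: "finite ?B" by (rule finite_subset[OF _ fin[of n]]) (use 3 in auto)
    have "\<Prod>?B dvd ((2 * m + 1) choose m)"
      by (rule prod_primes_dvd) (use finB prime_dvd_binomial in auto)
    then have "\<Prod>?B \<le> ((2 * m + 1) choose m)"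
      by (rule dvd_imp_le) simp
    then have B: "\<Prod>?B \<le> 4 ^ m" using choose_odd_middle_le le_trans by blast
    have A: "\<Prod>?A \<le> 4 ^ Suc m" by (rule less) (use 3 in auto)
    have "\<Prod>{p. prime p \<and> p \<le> n} = \<Prod>?A * \<Prod>?B"
      unfolding eq by (rule prod.union_disjoint) (use fin finB in auto)
    also have "\<dots> \<le> 4 ^ Suc m * 4 ^ m" by (rule mult_le_mono[OF A B])
    also have "\<dots> = 4 ^ n" using 3 by (simp flip: power_add add: mult_2)
    finally show ?thesis .
  qed
qed

lemma finite_real_le_nat: "finite {n::nat. P n \<and> real n \<le> x}"
  by (rule finite_subset[of _ "{..nat \<lfloor>x\<rfloor>}"]) (auto simp: le_nat_floor)

lemma finite_square_le_real: "finite {d::nat. P d \<and> real (d\<^sup>2) \<le> X}"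
proof (rule finite_subset[OF _ finite_real_le_nat[of "\<lambda>_. True" X]])
  have "real d \<le> X" if "real (d\<^sup>2) \<le> X" for d
  proof -
    have "d \<le> d\<^sup>2" by (simp add: power2_eq_square)
    then have "real d \<le> real (d\<^sup>2)" by (rule of_nat_mono)
    then show ?thesis using that by linarith
  qed
  then show "{d. P d \<and> real (d\<^sup>2) \<le> X} \<subseteq> {n. True \<and> real n \<le> X}" by blast
qed

section \<open>Sums and products over primes\<close>

lemma sum_ln_primes_le:
  fixes x :: real
  assumes "x \<ge> 0"
  shows "(\<Sum>p | prime p \<and> real p \<le> x. ln (real p)) \<le> ln 4 * x"
proof -
  define n where "n = nat \<lfloor>x\<rfloor>"
  have le: "real p \<le> x \<longleftrightarrow> p \<le> n" for p
    using assms unfolding n_def by (simp add: le_nat_iff le_floor_iff)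
  have "(\<Sum>p | prime p \<and> real p \<le> x. ln (real p)) = ln (\<Prod>p | prime p \<and> p \<le> n. real p)"
    unfolding le by (subst ln_prod) (auto simp: prime_gt_0_nat)
  also have "\<dots> = ln (real (\<Prod>{p. prime p \<and> p \<le> n}))" by simp
  also have "\<dots> \<le> ln (real (4 ^ n))"
    using primorial_le[of n]
    by (intro ln_mono) (simp_all add: prime_gt_0_nat prod_pos flip: of_nat_prod)
  also have "\<dots> = ln 4 * n" by (simp add: ln_realpow)
  also have "\<dots> \<le> ln 4 * x" using assms unfolding n_def by (intro mult_left_mono) (auto)
  finally show ?thesis .
qed

text \<open>On a block \<open>v < p <= 2 * v\<close> with \<open>v >= u\<close>, each
  \<open>1 / p\<close> is at most \<open>ln p / (v * ln u)\<close>, so the bound on the sum of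
  \<open>ln p\<close> gives \<open>2 * ln 4 / ln u\<close> per block. This is cruder than Mertens,
  but stays bounded when \<open>u\<close> is a fixed power of \<open>2 ^ j * u\<close>.\<close>

lemma sum_inverse_primes_dyadic_le:
  fixes u :: real
  assumes "u > 1"
  shows "(\<Sum>p | prime p \<and> u < real p \<and> real p \<le> 2 ^ j * u. 1 / real p) \<le> real j * (2 * ln 4 / ln u)"
proof (induction j)
  case 0
  have "{p. prime p \<and> u < real p \<and> real p \<le> 2 ^ 0 * u} = {}" by auto
  then show ?case by (simp only: sum.empty)
next
  case (Suc j)
  define v where "v = 2 ^ j * u"
  have v: "v \<ge> u" using assms unfolding v_def by (simp add: mult_le_cancel_right1)
  have fin: "finite {p. prime p \<and> s < real p \<and> real p \<le> t}" for s t
    using finite_real_le_nat[of "\<lambda>p. prime p \<and> s < real p" t] by (simp add: conj_assoc)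
  let ?B = "{p. prime p \<and> v < real p \<and> real p \<le> 2 * v}"
  have "(\<Sum>p\<in>?B. 1 / real p) \<le> (\<Sum>p\<in>?B. ln (real p) / (v * ln u))"
  proof (rule sum_mono)
    fix p assume p: "p \<in> ?B"
    then have "ln u \<le> ln (real p)" "v \<le> real p" using v assms by auto
    moreover have "0 < ln u" "0 < v" using v assms by auto
    ultimately have "v * ln u \<le> real p * ln (real p)" by (intro mult_mono) auto
    then show "1 / real p \<le> ln (real p) / (v * ln u)"
      using p \<open>0 < ln u\<close> \<open>0 < v\<close> by (simp add: field_simps)
  qed
  also have "\<dots> = (\<Sum>p\<in>?B. ln (real p)) / (v * ln u)" by (simp add: sum_divide_distrib)
  also have "\<dots> \<le> (ln 4 * (2 * v)) / (v * ln u)"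
  proof (rule divide_right_mono)
    have "(\<Sum>p\<in>?B. ln (real p)) \<le> (\<Sum>p | prime p \<and> real p \<le> 2 * v. ln (real p))"
      by (rule sum_mono2) (auto simp: finite_real_le_nat dest: prime_gt_0_nat)
    also have "\<dots> \<le> ln 4 * (2 * v)" using v assms by (intro sum_ln_primes_le) auto
    finally show "(\<Sum>p\<in>?B. ln (real p)) \<le> ln 4 * (2 * v)" .
  qed (use v assms in auto)
  also have "\<dots> = 2 * ln 4 / ln u" using v assms by simp
  finally have B: "(\<Sum>p\<in>?B. 1 / real p) \<le> 2 * ln 4 / ln u" .
  have "{p. prime p \<and> u < real p \<and> real p \<le> 2 ^ Suc j * u} =
      {p. prime p \<and> u < real p \<and> real p \<le> v} \<union> ?B"
    using v assms by (auto simp: v_def[symmetric] mult.assoc)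
  then have "(\<Sum>p | prime p \<and> u < real p \<and> real p \<le> 2 ^ Suc j * u. 1 / real p) =
      (\<Sum>p | prime p \<and> u < real p \<and> real p \<le> v. 1 / real p) + (\<Sum>p\<in>?B. 1 / real p)"
    by (simp only:) (rule sum.union_disjoint; use fin in auto)
  also have "\<dots> \<le> real j * (2 * ln 4 / ln u) + 2 * ln 4 / ln u"
    using Suc B unfolding v_def by (rule add_mono)
  also have "\<dots> = real (Suc j) * (2 * ln 4 / ln u)"
    by (simp add: add_divide_distrib distrib_right)
  finally show ?case .
qed

text \<open>The square of the \<open>k\<close>-th factor is at most \<open>(k + 1) / k\<close>, and
  these ratios telescope.\<close>

lemma prod_odd_le_sqrt: "(\<Prod>k=1..K. 1 + 1 / real (2 * k + 1)) \<le> sqrt (real K + 1)"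
proof (induction K)
  case (Suc K)
  have "(1 + 1 / real (2 * Suc K + 1))\<^sup>2 * (real K + 1) \<le> real (Suc K) + 1"
    by (simp add: divide_simps power2_eq_square) (simp add: algebra_simps)
  then have "(1 + 1 / real (2 * Suc K + 1)) * sqrt (real K + 1) \<le> sqrt (real (Suc K) + 1)"
    by (intro real_le_rsqrt) (simp add: power_mult_distrib)
  moreover have "(\<Prod>k=1..Suc K. 1 + 1 / real (2 * k + 1)) \<le>
      sqrt (real K + 1) * (1 + 1 / real (2 * Suc K + 1))"
    using mult_right_mono[OF Suc, of "1 + 1 / real (2 * Suc K + 1)"]
    by (subst prod.nat_ivl_Suc') (simp_all add: mult.commute)
  ultimately show ?case by (simp add: mult.commute)
qed auto

text \<open>Mertens would give a multiple of \<open>ln y\<close>; discarding only the even numbers is enough here.\<close>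

lemma prod_one_plus_inverse_primes_le:
  fixes y :: real
  assumes "y \<ge> 1"
  shows "(\<Prod>p | prime p \<and> real p \<le> y. 1 + 1 / real p) \<le> 2 * sqrt y"
proof -
  define K where "K = nat \<lfloor>y\<rfloor> div 2"
  have "{p. prime p \<and> real p \<le> y} \<subseteq> insert 2 ((\<lambda>k. 2 * k + 1) ` {1..K})"
  proof
    fix p assume p: "p \<in> {p. prime p \<and> real p \<le> y}"
    show "p \<in> insert 2 ((\<lambda>k. 2 * k + 1) ` {1..K})"
    proof (cases "p = 2")
      case False
      with p have "odd p" "p > 2" using prime_odd_nat[of p] prime_ge_2_nat[of p] by auto
      then obtain k where k: "p = 2 * k + 1" by (auto elim: oddE)
      have "p \<le> nat \<lfloor>y\<rfloor>" using p by (simp add: le_nat_floor)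
      then have "k \<in> {1..K}" unfolding K_def using k \<open>p > 2\<close> by auto
      with k show ?thesis by blast
    qed auto
  qed
  then have "(\<Prod>p | prime p \<and> real p \<le> y. 1 + 1 / real p) \<le>
      (\<Prod>p\<in>insert 2 ((\<lambda>k. 2 * k + 1) ` {1..K}). 1 + 1 / real p)"
    by (intro prod_mono2) auto
  also have "\<dots> = (1 + 1 / 2) * (\<Prod>k=1..K. 1 + 1 / real (2 * k + 1))"
    by (subst prod.insert) (auto simp: prod.reindex inj_on_def)
  also have "\<dots> \<le> 3 / 2 * sqrt (real K + 1)" using prod_odd_le_sqrt[of K] by simp
  also have "\<dots> \<le> 2 * sqrt y"
  proof -
    have "real (nat \<lfloor>y\<rfloor>) \<le> y" using assms by simp
    moreover have "real K \<le> real (nat \<lfloor>y\<rfloor>) / 2" unfolding K_def by linarith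
    \<comment> \<open>\<open>9/4\<close> is the square of the factor \<open>3/2\<close> of the prime
      2. With \<open>K <= y / 2\<close> and \<open>y >= 1\<close> the left side is at most
      \<open>27/8 * y\<close>.\<close>
    ultimately have "(9/4) * (real K + 1) \<le> 4 * y" using assms by argo
    then have "sqrt ((3 / 2)\<^sup>2 * (real K + 1)) \<le> sqrt (2\<^sup>2 * y)"
      by (intro real_sqrt_le_mono) (simp add: power2_eq_square)
    then show ?thesis by (simp add: real_sqrt_mult)
  qed
  finally show ?thesis .
qed

subsection \<open>Squarefree numbers with restricted prime factors\<close>

lemma prime_factors_prod_primes:
  fixes S :: "nat set"
  assumes "finite S" "\<And>p. p \<in> S \<Longrightarrow> prime p"
  shows "prime_factors (\<Prod>S) = S"
  using assms
proof (induction S rule: finite_induct)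
  case (insert p S)
  then have "\<Prod>S \<noteq> 0" "p \<noteq> 0" by (auto dest: prime_gt_0_nat)
  with insert show ?case by (simp add: prime_factors_product prime_prime_factors)
qed auto

lemma squarefree_prod_primes:
  fixes S :: "nat set"
  assumes "\<And>p. p \<in> S \<Longrightarrow> prime p"
  shows "squarefree (\<Prod>S)"
  using assms by (intro squarefree_prod_coprime) (auto intro: primes_coprime squarefree_prime)

lemma prod_prime_factors_squarefree:
  fixes d :: nat
  assumes "squarefree d"
  shows "\<Prod>(prime_factors d) = d"
proof -
  have d: "d > 0" using assms by (intro Nat.gr0I) auto
  have "d = (\<Prod>p\<in>prime_factors d. p ^ multiplicity p d)"
    using d by (simp add: prime_factorization_nat)
  also have "\<dots> = (\<Prod>p\<in>prime_factors d. p)"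
  proof (rule prod.cong[OF refl])
    fix p assume p: "p \<in> prime_factors d"
    then have "multiplicity p d \<le> 1"
      using assms d by (auto simp: squarefree_factorial_semiring'')
    moreover have "multiplicity p d \<ge> 1"
      using p d by (simp add: multiplicity_gt_zero_iff Suc_le_eq prime_factors_multiplicity)
    ultimately have "multiplicity p d = 1" by linarith
    then show "p ^ multiplicity p d = p" by simp
  qed
  finally show ?thesis by simp
qed

text \<open>Unique factorization. It converts sums over squarefree numbers into sums over sets of
  primes, which \<open>prod_add\<close> collapses to a product over \<open>P\<close>.\<close>

lemma bij_betw_prod_primes_squarefree:
  fixes P :: "nat set"
  assumes "finite P" "\<And>p. p \<in> P \<Longrightarrow> prime p"
  shows "bij_betw Prod (Pow P) {d. squarefree d \<and> prime_factors d \<subseteq> P}"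
proof (rule bij_betw_byWitness[where f' = prime_factors])
  have fin: "finite S" "\<And>p. p \<in> S \<Longrightarrow> prime p" if "S \<in> Pow P" for S
    using that assms finite_subset by auto
  show "\<forall>S\<in>Pow P. prime_factors (\<Prod>S) = S"
    by (auto intro!: prime_factors_prod_primes fin)
  show "\<forall>d\<in>{d. squarefree d \<and> prime_factors d \<subseteq> P}. \<Prod>(prime_factors d) = d"
    by (simp add: prod_prime_factors_squarefree)
  show "Prod ` Pow P \<subseteq> {d. squarefree d \<and> prime_factors d \<subseteq> P}"
  proof (rule image_subsetI)
    fix S assume S: "S \<in> Pow P"
    show "\<Prod>S \<in> {d. squarefree d \<and> prime_factors d \<subseteq> P}"
      using S prime_factors_prod_primes[OF fin[OF S]] squarefree_prod_primes[OF fin(2)[OF S]] by simp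
  qed
qed auto

section \<open>Detecting squarefree numbers by the Moebius function\<close>

lemma moebius_mu_square: "(moebius_mu n)\<^sup>2 = (if squarefree n then 1 else 0)"
  by (simp add: moebius_mu_def flip: power_mult)

text \<open>The squares dividing \<open>n\<close> are those of the divisors of its square part
  \<open>s\<close>. Only squarefree divisors count; they correspond to sets of primes dividing
  \<open>s\<close>, and the alternating sum over these sets is a product of factors
  \<open>-1 + 1\<close>, empty exactly when \<open>s = 1\<close>.\<close>

lemma sum_moebius_mu_square_dvd:
  fixes n :: nat
  assumes "n > 0"
  shows "(\<Sum>d | d\<^sup>2 dvd n. moebius_mu d) = (if squarefree n then 1 else 0)"
proof -
  define s where "s = square_part n"
  have s: "s > 0" using assms by (intro Nat.gr0I) (simp add: s_def)
  have dvd: "d\<^sup>2 dvd n \<longleftrightarrow> d dvd s" for d unfolding s_def by (simp add: dvd_square_part_iff)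
  let ?P = "prime_factors s"
  have eq: "squarefree d \<and> d dvd s \<longleftrightarrow> squarefree d \<and> prime_factors d \<subseteq> ?P" for d
  proof (intro conj_cong refl iffI)
    assume "d dvd s" then show "prime_factors d \<subseteq> ?P" using s by (simp add: dvd_prime_factors)
  next
    assume sq: "squarefree d" and sub: "prime_factors d \<subseteq> ?P"
    have "\<Prod>(prime_factors d) dvd s"
      using sub by (intro prod_primes_dvd) auto
    then show "d dvd s" using prod_prime_factors_squarefree[OF sq] by simp
  qed
  have "(\<Sum>d | d\<^sup>2 dvd n. moebius_mu d) = (\<Sum>d | squarefree d \<and> prime_factors d \<subseteq> ?P. moebius_mu d)"
    unfolding dvd eq[symmetric]
    using s by (intro sum.mono_neutral_right) (auto simp: moebius_mu_def)
  also have "\<dots> = (\<Sum>S\<in>Pow ?P. moebius_mu (\<Prod>S))"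
    by (rule sum.reindex_bij_betw[OF bij_betw_prod_primes_squarefree, symmetric]) auto
  also have "\<dots> = (\<Sum>S\<in>Pow ?P. (-1) ^ card S)"
  proof (rule sum.cong[OF refl])
    fix S assume "S \<in> Pow ?P"
    then have S: "finite S" "\<And>p. p \<in> S \<Longrightarrow> prime p"
      using finite_subset[of S ?P] by auto
    then show "moebius_mu (\<Prod>S) = (-1) ^ card S"
      using prime_factors_prod_primes[OF S] squarefree_prod_primes[OF S(2)]
      by (simp add: moebius_mu_def)
  qed
  also have "\<dots> = (\<Prod>p\<in>?P. (-1) + (1::int))"
    by (subst prod_add) (auto)
  also have "\<dots> = (if ?P = {} then 1 else 0)" by (simp add: card_gt_0_iff)
  also have "?P = {} \<longleftrightarrow> s = 1" using s by (simp add: prime_factorization_empty_iff)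
  also have "s = 1 \<longleftrightarrow> squarefree n"
  proof
    assume "s = 1" then show "squarefree n" by (intro squarefreeI) (simp add: dvd)
  next
    assume "squarefree n" then show "s = 1" using squarefreeD[of n s] dvd[of s] by simp
  qed
  finally show ?thesis .
qed

section \<open>Squarefree numbers built from primes in a given set\<close>

definition squarefree_over :: "nat set \<Rightarrow> real \<Rightarrow> nat set" where
  "squarefree_over Q x = {d. squarefree d \<and> prime_factors d \<subseteq> Q \<and> real d \<le> x}"

lemma finite_squarefree_over [simp]: "finite (squarefree_over Q x)"
  using finite_real_le_nat[of "\<lambda>d. squarefree d \<and> prime_factors d \<subseteq> Q" x]
  by (simp add: squarefree_over_def conj_assoc)

text \<open>Expanding the product yields \<open>1 / m\<close> for every squarefree \<open>m\<close>
  composed of the primes concerned. This includes all \<open>m\<close> in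
  \<open>squarefree_over Q x\<close>, since a prime factor of \<open>m\<close> is at most
  \<open>m <= x\<close>.\<close>

lemma sum_inverse_squarefree_over_le:
  "(\<Sum>m\<in>squarefree_over Q x. 1 / real m) \<le> (\<Prod>p | prime p \<and> p \<in> Q \<and> real p \<le> x. 1 + 1 / real p)"
proof -
  let ?P = "{p. prime p \<and> p \<in> Q \<and> real p \<le> x}"
  have fin: "finite ?P" using finite_real_le_nat[of "\<lambda>p. prime p \<and> p \<in> Q" x] by (simp add: conj_assoc)
  have bij: "bij_betw Prod (Pow ?P) {d. squarefree d \<and> prime_factors d \<subseteq> ?P}"
    by (rule bij_betw_prod_primes_squarefree) (use fin in auto)
  have "squarefree_over Q x \<subseteq> {d. squarefree d \<and> prime_factors d \<subseteq> ?P}"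
  proof safe
    fix d assume d: "d \<in> squarefree_over Q x"
    then show "squarefree d" by (simp add: squarefree_over_def)
    fix p assume p: "p \<in># prime_factorization d"
    then show "prime p" "p \<in> Q" using d by (auto simp: squarefree_over_def)
    have "p \<le> d" using p d by (intro dvd_imp_le) (auto simp: squarefree_over_def intro!: Nat.gr0I)
    then show "real p \<le> x" using d by (simp add: squarefree_over_def)
  qed
  then have "(\<Sum>m\<in>squarefree_over Q x. 1 / real m) \<le>
      (\<Sum>m | squarefree m \<and> prime_factors m \<subseteq> ?P. 1 / real m)"
    by (intro sum_mono2) (use bij_betw_finite[OF bij] fin in auto)
  also have "\<dots> = (\<Sum>S\<in>Pow ?P. 1 / real (\<Prod>S))"
    by (rule sum.reindex_bij_betw[OF bij, symmetric])
  also have "\<dots> = (\<Prod>p\<in>?P. 1 / real p + 1)"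
    by (subst prod_add[OF fin]) (simp add: prod_dividef)
  finally show ?thesis by (simp add: add.commute)
qed

text \<open>Writing \<open>ln d\<close> as a sum over the prime factors \<open>p\<close> of \<open>d\<close> and summing over \<open>p\<close> first,
  for fixed \<open>m = d div p\<close>, brings in the Chebyshev bound.\<close>

lemma sum_ln_squarefree_over_le:
  assumes "x \<ge> 0"
  shows "(\<Sum>d\<in>squarefree_over Q x. ln (real d)) \<le>
    ln 4 * x * (\<Prod>p | prime p \<and> p \<in> Q \<and> real p \<le> x. 1 + 1 / real p)"
proof -
  let ?T = "squarefree_over Q x"
  let ?R = "\<lambda>m. {p. prime p \<and> real p \<le> x / real m}"
  \<comment> \<open>Replaces \<open>d\<close> by its cofactor \<open>m\<close>. Multiplying back by
    \<open>p\<close> recovers \<open>d\<close>, so the map is injective; of the image only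
    \<open>p <= x / m\<close> is remembered, which leaves a Chebyshev sum for each
    \<open>m\<close>.\<close>
  let ?h = "\<lambda>(d::nat, p). (d div p, p)"
  have ln_eq: "ln (real d) = (\<Sum>p\<in>prime_factors d. ln (real p))" if "d \<in> ?T" for d
  proof -
    have "ln (real d) = ln (\<Prod>p\<in>prime_factors d. real p)"
      using that prod_prime_factors_squarefree[of d] by (simp add: squarefree_over_def flip: of_nat_prod)
    also have "\<dots> = (\<Sum>p\<in>prime_factors d. ln (real p))"
      by (rule ln_prod) (auto intro: prime_gt_0_nat)
    finally show ?thesis .
  qed
  have inj: "inj_on ?h (Sigma ?T prime_factors)"
  proof (rule inj_onI)
    fix y z assume "y \<in> Sigma ?T prime_factors" "z \<in> Sigma ?T prime_factors" "?h y = ?h z"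
    then obtain d e p where *: "y = (d, p)" "z = (e, p)" "d div p = e div p" "p dvd d" "p dvd e"
      by auto
    then have "d = e" by (metis dvd_div_mult_self)
    then show "y = z" using * by simp
  qed
  have sub: "?h ` Sigma ?T prime_factors \<subseteq> Sigma ?T ?R"
  proof (rule image_subsetI)
    fix y assume "y \<in> Sigma ?T prime_factors"
    then obtain d p where y: "y = (d, p)" and d: "d \<in> ?T" and p: "p \<in> prime_factors d"
      by blast
    then obtain m where m: "d = p * m" by (metis dvdE in_prime_factors_iff)
    have pos: "d \<noteq> 0" "p > 0" "m > 0" using d p m by (auto simp: squarefree_over_def intro: Nat.gr0I)
    have "squarefree m" using d m by (auto simp: squarefree_over_def dest: squarefree_multD)
    moreover have "prime_factors m \<subseteq> prime_factors d"
      using m pos by (intro dvd_prime_factors) auto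
    moreover have "m \<le> d" using m pos by simp
    ultimately have "m \<in> ?T" using d by (auto simp: squarefree_over_def)
    moreover have "real p * real m \<le> x" using d m by (simp add: squarefree_over_def)
    ultimately show "?h y \<in> Sigma ?T ?R"
      using p m pos y by (auto simp: field_simps)
  qed
  have "(\<Sum>d\<in>?T. ln (real d)) = (\<Sum>d\<in>?T. \<Sum>p\<in>prime_factors d. ln (real p))"
    by (rule sum.cong[OF refl ln_eq])
  also have "\<dots> = (\<Sum>y\<in>Sigma ?T prime_factors. ln (real (snd y)))"
    by (subst sum.Sigma) (auto simp: case_prod_unfold)
  also have "\<dots> = (\<Sum>y\<in>?h ` Sigma ?T prime_factors. ln (real (snd y)))"
    by (subst sum.reindex[OF inj]) (auto simp: case_prod_unfold)
  also have "\<dots> \<le> (\<Sum>y\<in>Sigma ?T ?R. ln (real (snd y)))"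
    by (rule sum_mono2[OF _ sub]) (auto intro!: finite_SigmaI simp: finite_real_le_nat dest: prime_gt_0_nat)
  also have "\<dots> = (\<Sum>m\<in>?T. \<Sum>p\<in>?R m. ln (real p))"
    by (subst sum.Sigma) (auto simp: case_prod_unfold finite_real_le_nat)
  also have "\<dots> \<le> (\<Sum>m\<in>?T. ln 4 * (x / real m))"
    by (intro sum_mono sum_ln_primes_le) (use assms in auto)
  also have "\<dots> = ln 4 * x * (\<Sum>m\<in>?T. 1 / real m)" by (simp add: sum_distrib_left)
  also have "\<dots> \<le> ln 4 * x * (\<Prod>p | prime p \<and> p \<in> Q \<and> real p \<le> x. 1 + 1 / real p)"
    by (intro mult_left_mono sum_inverse_squarefree_over_le) (use assms in auto)
  finally show ?thesis .
qed

subsection \<open>Reduction to counting solutions of congruences\<close>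

text \<open>The members are the numbers \<open>q * j + r\<close> up to \<open>M\<close>, and
  \<open>r\<close> is not 0 because \<open>b\<close> is a unit modulo \<open>q\<close>. Every
  \<open>j < M div q\<close> fits, and \<open>j = M div q\<close> is the only further
  candidate.\<close>

lemma card_cong_bounds:
  fixes q M :: nat and b :: int
  assumes "prime q" "coprime b (int q)"
  defines "A \<equiv> {m. 0 < m \<and> m \<le> M \<and> [int m = b] (mod int q)}"
  shows "M div q \<le> card A" "card A \<le> M div q + 1"
proof -
  have q: "q > 0" "q \<noteq> 1" using assms(1) prime_gt_1_nat[of q] by auto
  define r where "r = nat (b mod int q)"
  have r: "r < q" "int r = b mod int q" using q unfolding r_def by (auto simp: nat_less_iff)
  have "r \<noteq> 0"
  proof
    assume "r = 0"
    then have "int q dvd b" using r by auto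
    then have "is_unit (int q)" using assms(2) by (meson coprime_def dvd_refl)
    then show False using q by simp
  qed
  have cong_iff: "[int m = b] (mod int q) \<longleftrightarrow> m mod q = r" for m
    unfolding unique_euclidean_semiring_class.cong_def r(2)[symmetric] by (simp flip: of_nat_mod)
  define J where "J = {j. q * j + r \<le> M}"
  have J1: "J \<subseteq> {..M div q}"
  proof
    fix j assume "j \<in> J"
    then have "j * q \<le> M" by (simp add: J_def mult.commute)
    then show "j \<in> {..M div q}" using q by (simp add: less_eq_div_iff_mult_less_eq)
  qed
  have J2: "{..<M div q} \<subseteq> J"
  proof
    fix j assume "j \<in> {..<M div q}"
    then have "q * Suc j \<le> q * (M div q)" by (intro mult_le_mono2) auto
    also have "\<dots> \<le> M" by simp
    finally show "j \<in> J" using r by (simp add: J_def)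
  qed
  have "A = (\<lambda>j. q * j + r) ` J"
  proof (rule Set.set_eqI)
    fix m
    show "m \<in> A \<longleftrightarrow> m \<in> (\<lambda>j. q * j + r) ` J"
    proof
      assume "m \<in> A"
      then have "m mod q = r" "m \<le> M" by (auto simp: A_def cong_iff)
      then show "m \<in> (\<lambda>j. q * j + r) ` J"
        by (intro image_eqI[of _ _ "m div q"]) (auto simp: J_def)
    next
      assume "m \<in> (\<lambda>j. q * j + r) ` J"
      then show "m \<in> A" using \<open>r \<noteq> 0\<close> r(1) by (auto simp: A_def cong_iff J_def)
    qed
  qed
  moreover have "inj_on (\<lambda>j. q * j + r) J" using q by (auto intro: inj_onI)
  ultimately have card: "card A = card J" by (simp add: card_image)
  have fin: "finite J" using J1 finite_subset by blast
  show "M div q \<le> card A" unfolding card using card_mono[OF fin J2] by simp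
  show "card A \<le> M div q + 1" unfolding card using card_mono[OF _ J1] by simp
qed

lemma card_coprime_prime_eq:
  fixes q M :: nat
  assumes "prime q"
  shows "card {m. 0 < m \<and> m \<le> M \<and> coprime m q} = M - M div q"
proof -
  have q: "q > 0" using assms prime_gt_0_nat by blast
  have cop: "coprime m q \<longleftrightarrow> \<not> q dvd m" for m
    using assms by (metis coprime_commute coprime_absorb_left not_prime_unit prime_imp_coprime)
  have "{m. 0 < m \<and> m \<le> M \<and> q dvd m} = (*) q ` {1..M div q}"
  proof (rule Set.set_eqI)
    fix m show "m \<in> {m. 0 < m \<and> m \<le> M \<and> q dvd m} \<longleftrightarrow> m \<in> (*) q ` {1..M div q}"
      using q by (auto simp: less_eq_div_iff_mult_less_eq mult.commute elim!: dvdE intro!: image_eqI)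
  qed
  then have c: "card {m. 0 < m \<and> m \<le> M \<and> q dvd m} = M div q"
    using q by (simp add: card_image inj_on_def)
  have "{m. 0 < m \<and> m \<le> M \<and> coprime m q} = {1..M} - {m. 0 < m \<and> m \<le> M \<and> q dvd m}"
    by (auto simp: cop)
  also have "card \<dots> = card {1..M} - card {m. 0 < m \<and> m \<le> M \<and> q dvd m}"
    by (intro card_Diff_subset) (auto intro: finite_subset[of _ "{1..M}"])
  finally show ?thesis by (simp add: c)
qed

section \<open>The error term as a sum over square divisors\<close>

definition count_cong :: "real \<Rightarrow> nat \<Rightarrow> int \<Rightarrow> nat \<Rightarrow> nat" where
  "count_cong X q a d = card {m. 0 < m \<and> real (d\<^sup>2 * m) \<le> X \<and> [int (d\<^sup>2 * m) = a] (mod int q)}"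

definition count_coprime :: "real \<Rightarrow> nat \<Rightarrow> nat \<Rightarrow> nat" where
  "count_coprime X q d = card {m. 0 < m \<and> real (d\<^sup>2 * m) \<le> X \<and> coprime (d\<^sup>2 * m) q}"

text \<open>Insert the divisor sum for the square of \<open>moebius_mu n\<close>, exchange the
  summations and write \<open>n = d\<^sup>2 * m\<close>. The predicate \<open>P\<close> is left free
  so that both sums in \<open>E\<close> are covered.\<close>

lemma sum_moebius_mu_square_eq:
  "(\<Sum>n | 0 < n \<and> real n \<le> X \<and> P n. real_of_int ((moebius_mu n)\<^sup>2)) =
   (\<Sum>d | 0 < d \<and> real (d\<^sup>2) \<le> X. real_of_int (moebius_mu d) *
      real (card {m. 0 < m \<and> real (d\<^sup>2 * m) \<le> X \<and> P (d\<^sup>2 * m)}))"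
proof -
  define N where "N = {n. 0 < n \<and> real n \<le> X \<and> P n}"
  define D where "D = {d::nat. 0 < d \<and> real (d\<^sup>2) \<le> X}"
  have finN: "finite N"
    unfolding N_def by (rule finite_subset[OF _ finite_real_le_nat[of "\<lambda>_. True" X]]) auto
  have finD: "finite D" unfolding D_def by (rule finite_square_le_real)
  have 1: "real_of_int ((moebius_mu n)\<^sup>2) = (\<Sum>d\<in>D. if d\<^sup>2 dvd n then real_of_int (moebius_mu d) else 0)"
    if n: "n \<in> N" for n
  proof -
    have n0: "n > 0" using n by (simp add: N_def)
    have sub: "{d. d\<^sup>2 dvd n} \<subseteq> D"
    proof
      fix d assume "d \<in> {d. d\<^sup>2 dvd n}"
      then have d: "d\<^sup>2 dvd n" by simp
      have "d\<^sup>2 \<le> n" using d n0 by (rule dvd_imp_le)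
      then have "real (d\<^sup>2) \<le> real n" by (rule of_nat_mono)
      moreover have "d > 0" using d n0 by (intro Nat.gr0I) auto
      ultimately show "d \<in> D" using n unfolding D_def N_def by (auto simp del: of_nat_power)
    qed
    have "(moebius_mu n)\<^sup>2 = (\<Sum>d | d\<^sup>2 dvd n. moebius_mu d)"
      by (simp add: moebius_mu_square sum_moebius_mu_square_dvd[OF n0])
    also have "\<dots> = (\<Sum>d\<in>D. if d\<^sup>2 dvd n then moebius_mu d else 0)"
      using finD sub by (subst sum.inter_filter[symmetric]) (auto intro!: sum.cong)
    finally show ?thesis by (simp add: of_int_sum if_distrib cong: if_cong)
  qed
  have 2: "card {n\<in>N. d\<^sup>2 dvd n} = card {m. 0 < m \<and> real (d\<^sup>2 * m) \<le> X \<and> P (d\<^sup>2 * m)}"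
    if d: "d \<in> D" for d
  proof -
    have d0: "d\<^sup>2 > 0" using d by (simp add: D_def)
    have "{n\<in>N. d\<^sup>2 dvd n} = (*) (d\<^sup>2) ` {m. 0 < m \<and> real (d\<^sup>2 * m) \<le> X \<and> P (d\<^sup>2 * m)}"
      using d0 by (auto simp: N_def elim!: dvdE)
    moreover have "inj ((*) (d\<^sup>2))" using d0 by (auto intro: injI)
    ultimately show ?thesis by (simp add: card_image inj_on_subset)
  qed
  have "(\<Sum>n\<in>N. real_of_int ((moebius_mu n)\<^sup>2)) =
      (\<Sum>n\<in>N. \<Sum>d\<in>D. if d\<^sup>2 dvd n then real_of_int (moebius_mu d) else 0)"
    by (rule sum.cong[OF refl 1])
  also have "\<dots> = (\<Sum>d\<in>D. \<Sum>n\<in>N. if d\<^sup>2 dvd n then real_of_int (moebius_mu d) else 0)"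
    by (rule sum.swap)
  also have "\<dots> = (\<Sum>d\<in>D. real_of_int (moebius_mu d) * real (card {n\<in>N. d\<^sup>2 dvd n}))"
    using finN by (simp add: sum.inter_filter[symmetric] mult.commute)
  also have "\<dots> = (\<Sum>d\<in>D. real_of_int (moebius_mu d) *
      real (card {m. 0 < m \<and> real (d\<^sup>2 * m) \<le> X \<and> P (d\<^sup>2 * m)}))"
    by (intro sum.cong refl arg_cong2[where f = "(*)"] arg_cong[where f = real] 2)
  finally show ?thesis unfolding N_def D_def .
qed

lemma E_eq_sum_moebius_mu:
  assumes "prime q"
  shows "E X q a = (\<Sum>d | 0 < d \<and> real (d\<^sup>2) \<le> X. real_of_int (moebius_mu d) *
    (real (count_cong X q a d) - real (count_coprime X q d) / (real q - 1)))"
proof -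
  have tot: "real (totient q) = real q - 1"
    using assms prime_gt_0_nat[of q] by (simp add: totient_prime of_nat_diff)
  show ?thesis
    unfolding E_def sum_moebius_mu_square_eq count_cong_def count_coprime_def tot
    by (simp add: sum_distrib_left sum_subtractf[symmetric] right_diff_distrib mult_ac)
qed

section \<open>Counting for a single divisor\<close>

lemma real_square_mult_le_iff:
  fixes d m :: nat
  assumes "d > 0" "X \<ge> 0"
  shows "real (d\<^sup>2 * m) \<le> X \<longleftrightarrow> m \<le> nat \<lfloor>X / real (d\<^sup>2)\<rfloor>"
proof -
  have "real (d\<^sup>2 * m) \<le> X \<longleftrightarrow> real m \<le> X / real (d\<^sup>2)"
    using assms by (simp add: field_simps)
  also have "\<dots> \<longleftrightarrow> m \<le> nat \<lfloor>X / real (d\<^sup>2)\<rfloor>"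
    using assms by (simp add: le_nat_iff le_floor_iff)
  finally show ?thesis .
qed

lemma cong_prime_not_dvd:
  fixes q k :: nat and a :: int
  assumes "prime q" "coprime a (int q)" "[int k = a] (mod int q)"
  shows "\<not> q dvd k"
proof
  assume "q dvd k"
  then have "int q dvd a" using assms(3) by (simp add: cong_dvd_iff[symmetric] cong_sym_eq)
  then have "is_unit (int q)" using assms(2) by (meson coprime_def dvd_refl)
  then show False using assms(1) by auto
qed

text \<open>Multiplication by an inverse \<open>u\<close> of \<open>d\<^sup>2\<close> modulo
  \<open>q\<close> gives \<open>b = u * a\<close>, again a unit, so the cofactors \<open>m\<close>
  run through one reduced residue class and \<open>card_cong_bounds\<close> applies.\<close>

lemma cong_square_mult_iff:
  fixes q d :: nat and a :: int
  assumes "prime q" "coprime a (int q)" "\<not> q dvd d"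
  obtains b where "coprime b (int q)"
    "\<And>m. [int (d\<^sup>2 * m) = a] (mod int q) \<longleftrightarrow> [int m = b] (mod int q)"
proof -
  have "coprime (int (d\<^sup>2)) (int q)"
    using assms prime_imp_coprime[of q d] by (simp add: coprime_commute)
  then obtain u where u: "[int (d\<^sup>2) * u = 1] (mod int q)" using cong_solve_coprime_int by blast
  then have cu: "coprime u (int q)"
    by (metis coprime_iff_invertible_int mult.commute)
  show thesis
  proof (rule that[of "u * a"])
    show "coprime (u * a) (int q)" using cu assms by simp
    fix m
    have "[int (d\<^sup>2 * m) = a] (mod int q) \<longleftrightarrow> [u * int (d\<^sup>2 * m) = u * a] (mod int q)"
      using cu by (simp add: cong_mult_lcancel)
    also have "[u * int (d\<^sup>2 * m) = int m] (mod int q)"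
      using cong_scalar_right[OF u, of "int m"] by (simp add: mult_ac)
    then have "[u * int (d\<^sup>2 * m) = u * a] (mod int q) \<longleftrightarrow> [int m = u * a] (mod int q)"
      by (meson cong_sym cong_trans)
    finally show "[int (d\<^sup>2 * m) = a] (mod int q) \<longleftrightarrow> [int m = u * a] (mod int q)" .
  qed
qed

lemma count_cong_bounds:
  assumes "prime q" "coprime a (int q)" "\<not> q dvd d" "X \<ge> 0"
  defines "M \<equiv> nat \<lfloor>X / real (d\<^sup>2)\<rfloor>"
  shows "M div q \<le> count_cong X q a d" "count_cong X q a d \<le> M div q + 1"
proof -
  have d: "d > 0" using assms(3) by (intro Nat.gr0I) auto
  obtain b where b: "coprime b (int q)"
    "\<And>m. [int (d\<^sup>2 * m) = a] (mod int q) \<longleftrightarrow> [int m = b] (mod int q)"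
    using cong_square_mult_iff[OF assms(1-3)] by blast
  have "count_cong X q a d = card {m. 0 < m \<and> m \<le> M \<and> [int m = b] (mod int q)}"
    unfolding count_cong_def b(2) real_square_mult_le_iff[OF d assms(4)] M_def ..
  then show "M div q \<le> count_cong X q a d" "count_cong X q a d \<le> M div q + 1"
    using card_cong_bounds[OF assms(1) b(1), of M] by simp_all
qed

lemma count_cong_eq_0:
  assumes "\<And>m. 0 < m \<Longrightarrow> real (d\<^sup>2 * m) \<le> X \<Longrightarrow> \<not> [int (d\<^sup>2 * m) = a] (mod int q)"
  shows "count_cong X q a d = 0"
proof -
  have "{m. 0 < m \<and> real (d\<^sup>2 * m) \<le> X \<and> [int (d\<^sup>2 * m) = a] (mod int q)} = {}"
    using assms by blast
  then show ?thesis unfolding count_cong_def by (simp only: card.empty)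
qed

lemma count_coprime_eq:
  assumes "prime q" "\<not> q dvd d" "X \<ge> 0"
  defines "M \<equiv> nat \<lfloor>X / real (d\<^sup>2)\<rfloor>"
  shows "count_coprime X q d = M - M div q"
proof -
  have d: "d > 0" using assms(2) by (intro Nat.gr0I) auto
  have "coprime (d\<^sup>2) q"
    using assms prime_imp_coprime[of q d] by (simp add: coprime_commute)
  then have "coprime (d\<^sup>2 * m) q \<longleftrightarrow> coprime m q" for m by simp
  then show ?thesis
    unfolding count_coprime_def real_square_mult_le_iff[OF d assms(3)] M_def
    by (simp only: card_coprime_prime_eq[OF assms(1)])
qed

lemma count_coprime_eq_0:
  assumes "prime q" "q dvd d"
  shows "count_coprime X q d = 0"
proof -
  have "\<not> coprime (d\<^sup>2 * m) q" for m
  proof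
    assume "coprime (d\<^sup>2 * m) q"
    then have "coprime d q" by simp
    then have "is_unit q" using assms(2) by (meson coprime_def dvd_refl)
    then show False using assms(1) by auto
  qed
  then have "{m. 0 < m \<and> real (d\<^sup>2 * m) \<le> X \<and> coprime (d\<^sup>2 * m) q} = {}" by blast
  then show ?thesis unfolding count_coprime_def by (simp only: card.empty)
qed

text \<open>If \<open>q\<close> divides \<open>d\<close>, both counts vanish. Otherwise let
  \<open>k = M div q\<close>: the first count lies between \<open>k\<close> and
  \<open>k + 1\<close>, and so does \<open>(M - k) / (q - 1)\<close>, because \<open>M\<close> is
  \<open>q * k\<close> plus a remainder of at most \<open>q - 1\<close>.\<close>

lemma abs_count_diff_le_1:
  assumes "prime q" "coprime a (int q)" "X \<ge> 0"
  shows "\<bar>real (count_cong X q a d) - real (count_coprime X q d) / (real q - 1)\<bar> \<le> 1"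
proof (cases "q dvd d")
  case True
  then have "q dvd d\<^sup>2 * m" for m by (simp add: power2_eq_square)
  then have "count_cong X q a d = 0"
    using cong_prime_not_dvd[OF assms(1,2)] by (intro count_cong_eq_0) blast
  then show ?thesis using count_coprime_eq_0[OF assms(1) True] by simp
next
  case False
  define M where "M = nat \<lfloor>X / real (d\<^sup>2)\<rfloor>"
  define k where "k = M div q"
  have q: "real q > 1" using assms(1) prime_gt_1_nat by simp
  have A: "real k \<le> real (count_cong X q a d)" "real (count_cong X q a d) \<le> real k + 1"
    using count_cong_bounds[OF assms(1,2) False assms(3)] unfolding k_def M_def by linarith+
  have M: "M = q * k + M mod q" "M mod q < q"
    using q unfolding k_def by (simp_all)
  have "k \<le> M" unfolding k_def by simp
  then have B: "real (count_coprime X q d) = real M - real k"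
    using count_coprime_eq[OF assms(1) False assms(3)] by (simp add: k_def M_def of_nat_diff)
  have "real M = real q * real k + real (M mod q)" using M(1) by (metis of_nat_add of_nat_mult)
  moreover have "real (M mod q) \<le> real q - 1" using M(2) by linarith
  ultimately have "real k * (real q - 1) \<le> real M - real k" "real M - real k \<le> (real k + 1) * (real q - 1)"
    by (simp_all add: algebra_simps)
  then have "real k \<le> (real M - real k) / (real q - 1)" "(real M - real k) / (real q - 1) \<le> real k + 1"
    using q by (simp_all add: pos_le_divide_eq pos_divide_le_eq)
  then show ?thesis using A unfolding B by linarith
qed

lemma count_coprime_le:
  assumes "prime q" "X \<ge> 0" "d > 0"
  shows "real (count_coprime X q d) / (real q - 1) \<le> 2 * X / (real q * (real d)\<^sup>2)"
proof (cases "q dvd d")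
  case True
  then show ?thesis using count_coprime_eq_0[OF assms(1) True] assms by simp
next
  case False
  have q: "real q \<ge> 2" using prime_ge_2_nat[OF assms(1)] by simp
  have "count_coprime X q d \<le> nat \<lfloor>X / real (d\<^sup>2)\<rfloor>"
    using count_coprime_eq[OF assms(1) False assms(2)] by simp
  then have "real (count_coprime X q d) \<le> real (nat \<lfloor>X / real (d\<^sup>2)\<rfloor>)" by (rule of_nat_mono)
  also have "\<dots> \<le> X / real (d\<^sup>2)" using assms by (intro of_nat_floor) auto
  \<comment> \<open>The factor 2 in the claim pays for replacing \<open>q - 1\<close> by
    \<open>q / 2\<close>.\<close>
  finally have "real (count_coprime X q d) / (real q - 1) \<le> (X / (real d)\<^sup>2) / (real q / 2)"
    using q assms by (intro frac_le) auto
  then show ?thesis by (simp add: field_simps)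
qed

text \<open>The rounding error 1 is charged only if a solution \<open>m\<close> exists at all. This
  reduces the middle range to counting the \<open>d\<close> that have a solution.\<close>

lemma count_cong_le:
  assumes "prime q" "coprime a (int q)" "X \<ge> 0" "d > 0"
  shows "real (count_cong X q a d) \<le> X / (real q * (real d)\<^sup>2) +
    of_bool (\<exists>m>0. real (d\<^sup>2 * m) \<le> X \<and> [int (d\<^sup>2 * m) = a] (mod int q))"
proof (cases "\<exists>m>0. real (d\<^sup>2 * m) \<le> X \<and> [int (d\<^sup>2 * m) = a] (mod int q)")
  case True
  then have nd: "\<not> q dvd d"
    using cong_prime_not_dvd[OF assms(1,2)] by (metis dvd_mult2 dvd_power zero_less_numeral dvd_trans)
  define M where "M = nat \<lfloor>X / real (d\<^sup>2)\<rfloor>"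
  have q: "real q > 0" using prime_gt_0_nat[OF assms(1)] by simp
  have "real (count_cong X q a d) \<le> real (M div q) + 1"
    using count_cong_bounds(2)[OF assms(1,2) nd assms(3)] unfolding M_def by linarith
  moreover have "real (M div q) \<le> real M / real q"
    using q by (simp add: pos_le_divide_eq flip: of_nat_mult)
  moreover have "real M / real q \<le> (X / (real d)\<^sup>2) / real q"
    using q assms of_nat_floor[of "X / (real d)\<^sup>2"] unfolding M_def by (intro divide_right_mono) auto
  ultimately show ?thesis using True by (simp add: mult.commute)
next
  case False
  then have "count_cong X q a d = 0" by (intro count_cong_eq_0) blast
  then show ?thesis using assms by simp
qed

text \<open>If \<open>d\<close> and \<open>e\<close> both solve the congruence, \<open>q\<close>
  divides \<open>(d - e) * (d + e) * m\<close> but not \<open>m\<close>. Hence all solutions lie in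
  the classes of \<open>e\<close> and \<open>-e\<close>, each with at most
  \<open>M div q + 1\<close> members.\<close>

lemma card_square_roots_le:
  fixes q m M :: nat and a :: int
  assumes "prime q" "coprime a (int q)"
  shows "card {d. 0 < d \<and> d \<le> M \<and> [int (d\<^sup>2 * m) = a] (mod int q)} \<le> 2 * (M div q + 1)"
proof (cases "\<exists>e. [int (e\<^sup>2 * m) = a] (mod int q)")
  case True
  then obtain e where e: "[int (e\<^sup>2 * m) = a] (mod int q)" by blast
  have pq: "prime (int q)" using assms by simp
  have "\<not> q dvd e\<^sup>2 * m" by (rule cong_prime_not_dvd[OF assms e])
  then have nd: "\<not> q dvd e" "\<not> q dvd m" by (auto simp: power2_eq_square)
  then have cop: "coprime (int e) (int q)" "coprime (- int e) (int q)"
    using prime_imp_coprime[OF assms(1)] by (auto simp: coprime_commute)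
  have "[int d = int e] (mod int q) \<or> [int d = - int e] (mod int q)"
    if "[int (d\<^sup>2 * m) = a] (mod int q)" for d
  proof -
    have "[int (d\<^sup>2 * m) = int (e\<^sup>2 * m)] (mod int q)" using that e cong_trans cong_sym by blast
    then have "int q dvd (int d - int e) * (int d + int e) * int m"
      by (simp add: cong_iff_dvd_diff algebra_simps power2_eq_square)
    then have "int q dvd int d - int e \<or> int q dvd int d + int e"
      using nd pq by (auto simp: prime_dvd_mult_iff)
    then show ?thesis by (auto simp: cong_iff_dvd_diff)
  qed
  then have "{d. 0 < d \<and> d \<le> M \<and> [int (d\<^sup>2 * m) = a] (mod int q)} \<subseteq>
      {d. 0 < d \<and> d \<le> M \<and> [int d = int e] (mod int q)} \<union> {d. 0 < d \<and> d \<le> M \<and> [int d = - int e] (mod int q)}"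
    (is "?L \<subseteq> ?A \<union> ?B") by blast
  moreover have "finite ?A" "finite ?B" by (auto intro: finite_subset[of _ "{..M}"])
  ultimately have "card ?L \<le> card (?A \<union> ?B)" by (intro card_mono) auto
  also have "\<dots> \<le> card ?A + card ?B" by (rule card_Un_le)
  also have "\<dots> \<le> (M div q + 1) + (M div q + 1)"
    by (intro add_mono card_cong_bounds(2)[OF assms(1)] cop)
  finally show ?thesis by simp
next
  case False
  then have "{d. 0 < d \<and> d \<le> M \<and> [int (d\<^sup>2 * m) = a] (mod int q)} = {}" by blast
  then show ?thesis by (simp only: card.empty)
qed

subsection \<open>Bounding the error term\<close>

text \<open>With \<open>k\<close> the integer part of \<open>D\<close>, the sum telescopes through
  \<open>1 / (n + 1)\<^sup>2 <= 1 / n - 1 / (n + 1)\<close> to at most \<open>1 / k\<close>, and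
  \<open>D < k + 1 <= 2 * k\<close>.\<close>

lemma sum_inverse_squares_le:
  fixes D :: real
  assumes "D \<ge> 1" "finite S" "\<And>d. d \<in> S \<Longrightarrow> D < real d"
  shows "(\<Sum>d\<in>S. 1 / (real d)\<^sup>2) \<le> 2 / D"
proof -
  define k where "k = nat \<lfloor>D\<rfloor>"
  have k: "k \<ge> 1" "real k \<le> D" "D < real k + 1"
    using assms(1) unfolding k_def by (auto simp: le_nat_floor of_nat_floor)
  define N where "N = max k (Max (insert 0 S))"
  have ind: "(\<Sum>d\<in>{k<..n}. 1 / (real d)\<^sup>2) \<le> 1 / real k - 1 / real n" if "n \<ge> k" for n
    using that
  proof (induction n rule: dec_induct)
    case (step n)
    have n: "real n > 0" using step k by simp
    have "1 / (real (Suc n))\<^sup>2 \<le> 1 / real n - 1 / real (Suc n)"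
      using n by (simp add: divide_simps power2_eq_square)
    moreover have "{k<..Suc n} = insert (Suc n) {k<..n}" using step by auto
    ultimately show ?case using step by simp
  qed auto
  have "S \<subseteq> {k<..N}"
  proof
    fix d assume d: "d \<in> S"
    then have "real k < real d" using assms(3)[OF d] k by linarith
    moreover have "d \<le> Max (insert 0 S)" using d assms(2) by (intro Max_ge) auto
    ultimately show "d \<in> {k<..N}" by (simp add: N_def)
  qed
  then have "(\<Sum>d\<in>S. 1 / (real d)\<^sup>2) \<le> (\<Sum>d\<in>{k<..N}. 1 / (real d)\<^sup>2)"
    by (intro sum_mono2) auto
  also have "\<dots> \<le> 1 / real k - 1 / real N" by (rule ind) (simp add: N_def)
  also have "\<dots> \<le> 1 / real k" by simp
  also have "\<dots> \<le> 2 / D" using k by (simp add: field_simps)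
  finally show ?thesis .
qed

lemma card_pos_le_real:
  assumes "y \<ge> 0"
  shows "real (card {n::nat. 0 < n \<and> real n \<le> y}) \<le> y"
proof -
  have "{n::nat. 0 < n \<and> real n \<le> y} = {1..nat \<lfloor>y\<rfloor>}"
    using assms by (auto simp: le_nat_iff le_floor_iff Suc_le_eq)
  then show ?thesis using assms by (simp add: of_nat_floor)
qed

text \<open>The pairs \<open>(d, m)\<close> are counted by \<open>m\<close> instead of by
  \<open>d\<close>. A \<open>d\<close> beyond \<open>D\<close> forces
  \<open>m <= X / D\<^sup>2\<close>, and each \<open>m\<close> admits at most
  \<open>2 * (M div q + 1)\<close> values \<open>d <= sqrt X\<close>.\<close>

lemma sum_count_cong_large_le:
  assumes "prime q" "coprime a (int q)" "X \<ge> 0" "D > 0"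
  shows "real (\<Sum>d | D < real d \<and> real (d\<^sup>2) \<le> X. count_cong X q a d) \<le>
    X / D\<^sup>2 * (2 * (sqrt X / real q + 1))"
proof -
  let ?T = "{d. D < real d \<and> real (d\<^sup>2) \<le> X}"
  let ?F = "\<lambda>d. {m. 0 < m \<and> real (d\<^sup>2 * m) \<le> X \<and> [int (d\<^sup>2 * m) = a] (mod int q)}"
  let ?Ms = "{m::nat. 0 < m \<and> real m \<le> X / D\<^sup>2}"
  define M where "M = nat \<lfloor>sqrt X\<rfloor>"
  let ?G = "\<lambda>m. {d. 0 < d \<and> d \<le> M \<and> [int (d\<^sup>2 * m) = a] (mod int q)}"
  have mle: "real m \<le> X / D\<^sup>2" if "d \<in> ?T" "m \<in> ?F d" for d m
  proof -
    have "D\<^sup>2 * real m \<le> (real d)\<^sup>2 * real m"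
      using that assms by (intro mult_right_mono power_mono) auto
    also have "\<dots> \<le> X" using that by simp
    finally show ?thesis using assms by (simp add: field_simps)
  qed
  have finF: "finite (?F d)" if "d \<in> ?T" for d
    by (rule finite_subset[OF _ finite_real_le_nat[of "\<lambda>_. True" "X / D\<^sup>2"]]) (use mle[OF that] in blast)
  have finM: "finite ?Ms" by (rule finite_real_le_nat)
  have finG: "finite (?G m)" for m by (rule finite_subset[of _ "{..M}"]) auto
  have finT: "finite ?T" by (rule finite_square_le_real)
  have "prod.swap ` Sigma ?T ?F \<subseteq> Sigma ?Ms ?G"
  proof (rule image_subsetI)
    fix y assume "y \<in> Sigma ?T ?F"
    then obtain d m where y: "y = (d, m)" and *: "D < real d" "real (d\<^sup>2) \<le> X" "0 < m"
      "real (d\<^sup>2 * m) \<le> X" "[int (d\<^sup>2 * m) = a] (mod int q)" by blast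
    have "(real d)\<^sup>2 \<le> X" using *(2) by simp
    then have "real d \<le> sqrt X" by (rule real_le_rsqrt)
    then have "d \<le> M" unfolding M_def by (rule le_nat_floor)
    moreover have "real m \<le> X / D\<^sup>2" using * by (intro mle[of d]) auto
    moreover have "0 < d" using *(1) assms(4) by (intro Nat.gr0I) auto
    ultimately show "prod.swap y \<in> Sigma ?Ms ?G" using * y by simp
  qed
  then have "card (prod.swap ` Sigma ?T ?F) \<le> card (Sigma ?Ms ?G)"
    using finM finG by (intro card_mono finite_SigmaI) auto
  then have "card (Sigma ?T ?F) \<le> card (Sigma ?Ms ?G)" by (simp add: card_image)
  then have "(\<Sum>d\<in>?T. count_cong X q a d) \<le> (\<Sum>m\<in>?Ms. card (?G m))"
    unfolding count_cong_def using finT finF finM finG by (subst (asm) (1 2) card_SigmaI) auto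
  also have "\<dots> \<le> (\<Sum>m\<in>?Ms. 2 * (M div q + 1))"
    by (intro sum_mono card_square_roots_le assms)
  also have "\<dots> = card ?Ms * (2 * (M div q + 1))" by simp
  finally have "real (\<Sum>d\<in>?T. count_cong X q a d) \<le> real (card ?Ms * (2 * (M div q + 1)))"
    by (rule of_nat_mono)
  also have "\<dots> = real (card ?Ms) * (2 * (real (M div q) + 1))"
    by (simp only: of_nat_mult of_nat_add of_nat_1 of_nat_numeral)
  also have "\<dots> \<le> X / D\<^sup>2 * (2 * (sqrt X / real q + 1))"
  proof (intro mult_mono add_mono order.refl)
    show "real (card ?Ms) \<le> X / D\<^sup>2" using assms by (intro card_pos_le_real) auto
    have q: "real q > 0" using prime_gt_0_nat[OF assms(1)] by simp
    have "real (M div q) \<le> real M / real q"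
      using q by (simp add: pos_le_divide_eq flip: of_nat_mult)
    also have "\<dots> \<le> sqrt X / real q"
      using q assms unfolding M_def by (intro divide_right_mono of_nat_floor) auto
    finally show "real (M div q) \<le> sqrt X / real q" .
  qed (use assms in auto)
  finally show ?thesis .
qed

section \<open>Divisors in the middle range\<close>

text \<open>The existence of \<open>m\<close> is the event in the indicator of
  \<open>count_cong_le\<close>; numbers that are not squarefree are left out because
  \<open>moebius_mu\<close> vanishes there.\<close>

definition middle_divisors :: "real \<Rightarrow> nat \<Rightarrow> int \<Rightarrow> real \<Rightarrow> real \<Rightarrow> nat set" where
  "middle_divisors X q a D0 D1 = {d. squarefree d \<and> D0 < real d \<and> real d \<le> D1 \<and>
     (\<exists>m>0. real (d\<^sup>2 * m) \<le> X \<and> [int (d\<^sup>2 * m) = a] (mod int q))}"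

lemma finite_middle_divisors [simp]: "finite (middle_divisors X q a D0 D1)"
  by (rule finite_subset[OF _ finite_real_le_nat[of "\<lambda>_. True" D1]]) (auto simp: middle_divisors_def)

text \<open>The four terms come from the \<open>d\<close> up to \<open>D0\<close>, each contributing
  at most 1; the density terms over all \<open>d > D0\<close>; the rounding errors of the middle
  divisors; and the full counts for \<open>d > D1\<close>.\<close>

lemma abs_E_le:
  assumes "prime q" "coprime a (int q)" "X \<ge> 0" "D0 \<ge> 1" "D1 \<ge> D0"
  shows "\<bar>E X q a\<bar> \<le> D0 + 6 * X / (real q * D0) + real (card (middle_divisors X q a D0 D1)) +
    X / D1\<^sup>2 * (2 * (sqrt X / real q + 1))"
proof -
  let ?D = "{d. 0 < d \<and> real (d\<^sup>2) \<le> X}"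
  let ?G = "middle_divisors X q a D0 D1"
  let ?A = "\<lambda>d. real (count_cong X q a d)" and ?B = "\<lambda>d. real (count_coprime X q d) / (real q - 1)"
  define t1 where "t1 = (\<lambda>d. of_bool (real d \<le> D0) :: real)"
  \<comment> \<open>\<open>3\<close> adds the \<open>1\<close> of \<open>count_cong_le\<close> and
    the \<open>2\<close> of \<open>count_coprime_le\<close>; summing the inverse squares doubles it
    to the \<open>6\<close> of the claim.\<close>
  define t2 where "t2 = (\<lambda>d. if D0 < real d then 3 * X / real q * (1 / (real d)\<^sup>2) else 0)"
  define t3 where "t3 = (\<lambda>d. of_bool (d \<in> ?G) :: real)"
  define t4 where "t4 = (\<lambda>d. if D1 < real d then ?A d else 0)"
  have q: "real q > 1" using assms(1) prime_gt_1_nat by simp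
  have finD: "finite ?D" by (rule finite_square_le_real)
  have term_le: "\<bar>real_of_int (moebius_mu d) * (?A d - ?B d)\<bar> \<le> t1 d + t2 d + t3 d + t4 d"
    if d: "d \<in> ?D" for d
  proof -
    have mu: "\<bar>real_of_int (moebius_mu d)\<bar> \<le> of_bool (squarefree d)"
      by (simp add: moebius_mu_def)
    have le: "\<bar>real_of_int (moebius_mu d) * (?A d - ?B d)\<bar> \<le> of_bool (squarefree d) * \<bar>?A d - ?B d\<bar>"
      unfolding abs_mult by (intro mult_right_mono mu) auto
    have B0: "?B d \<ge> 0" using q by simp
    then have AB: "\<bar>?A d - ?B d\<bar> \<le> ?A d + ?B d" by simp
    have B: "?B d \<le> 2 * (X / (real q * (real d)\<^sup>2))"
      using count_coprime_le[OF assms(1,3), of d] d by simp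
    have pos: "0 \<le> X / (real q * (real d)\<^sup>2)" using assms by simp
    have t2: "t2 d = (if D0 < real d then 3 * (X / (real q * (real d)\<^sup>2)) else 0)"
      by (simp add: t2_def)
    have nonneg: "t1 d \<ge> 0" "t2 d \<ge> 0" "t3 d \<ge> 0" "t4 d \<ge> 0"
      using pos unfolding t2 by (auto simp: t1_def t3_def t4_def)
    show ?thesis
    proof (cases "squarefree d")
      case False
      then have "moebius_mu d = 0" by (simp add: moebius_mu_def)
      then show ?thesis using nonneg by simp
    next
      case True
      consider "real d \<le> D0" | "D0 < real d" "real d \<le> D1" | "D1 < real d" by linarith
      then show ?thesis
      proof cases
        case 1
        then have "t1 d = 1" by (simp add: t1_def)
        then show ?thesis using le True abs_count_diff_le_1[OF assms(1-3), of d] nonneg by simp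
      next
        case 2
        then have "?A d \<le> X / (real q * (real d)\<^sup>2) + t3 d"
          using count_cong_le[OF assms(1-3), of d] d True by (simp add: t3_def middle_divisors_def)
        moreover have "t2 d = 3 * (X / (real q * (real d)\<^sup>2))" unfolding t2 using 2 by simp
        moreover have "\<bar>real_of_int (moebius_mu d) * (?A d - ?B d)\<bar> \<le> ?A d + ?B d"
          using le True AB by simp
        ultimately show ?thesis using B nonneg(1,4) by argo
      next
        case 3
        then have "t4 d = ?A d" "D0 < real d" using assms by (auto simp: t4_def)
        moreover from this have "t2 d = 3 * (X / (real q * (real d)\<^sup>2))" unfolding t2 by simp
        moreover have "\<bar>real_of_int (moebius_mu d) * (?A d - ?B d)\<bar> \<le> ?A d + ?B d"
          using le True AB by simp
        ultimately show ?thesis using B pos nonneg(1,3) by argo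
      qed
    qed
  qed
  have "\<bar>E X q a\<bar> \<le> (\<Sum>d\<in>?D. \<bar>real_of_int (moebius_mu d) * (?A d - ?B d)\<bar>)"
    unfolding E_eq_sum_moebius_mu[OF assms(1)] by (rule sum_abs)
  also have "\<dots> \<le> (\<Sum>d\<in>?D. t1 d + t2 d + t3 d + t4 d)"
    by (rule sum_mono) (rule term_le)
  also have "\<dots> = sum t1 ?D + sum t2 ?D + sum t3 ?D + sum t4 ?D"
    by (simp add: sum.distrib)
  also have "\<dots> \<le> D0 + 6 * X / (real q * D0) + real (card ?G) + X / D1\<^sup>2 * (2 * (sqrt X / real q + 1))"
  proof (intro add_mono)
    have "sum t1 ?D = real (card (?D \<inter> {d. real d \<le> D0}))"
      unfolding t1_def using finD by (simp add: sum_of_bool_eq)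
    also have "\<dots> \<le> real (card {d::nat. 0 < d \<and> real d \<le> D0})"
      by (intro of_nat_mono card_mono finite_real_le_nat) auto
    also have "\<dots> \<le> D0" using assms by (intro card_pos_le_real) auto
    finally show "sum t1 ?D \<le> D0" .
    have "sum t2 ?D = (\<Sum>d\<in>{d\<in>?D. D0 < real d}. 3 * X / real q * (1 / (real d)\<^sup>2))"
      unfolding t2_def using finD by (rule sum.inter_filter[symmetric])
    also have "\<dots> = 3 * X / real q * (\<Sum>d\<in>{d\<in>?D. D0 < real d}. 1 / (real d)\<^sup>2)"
      by (rule sum_distrib_left[symmetric])
    also have "\<dots> \<le> 3 * X / real q * (2 / D0)"
      using assms finite_subset[OF _ finD, of "{d\<in>?D. D0 < real d}"]
      by (intro mult_left_mono sum_inverse_squares_le) auto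
    finally show "sum t2 ?D \<le> 6 * X / (real q * D0)" by simp
    have "sum t3 ?D = real (card (?D \<inter> ?G))"
      unfolding t3_def using finD by (simp add: sum_of_bool_eq)
    also have "\<dots> \<le> real (card ?G)" by (intro of_nat_mono card_mono) auto
    finally show "sum t3 ?D \<le> real (card ?G)" .
    have "sum t4 ?D = (\<Sum>d\<in>{d\<in>?D. D1 < real d}. ?A d)"
      unfolding t4_def using finD by (rule sum.inter_filter[symmetric])
    also have "{d\<in>?D. D1 < real d} = {d. D1 < real d \<and> real (d\<^sup>2) \<le> X}"
      using assms by (auto intro!: Nat.gr0I)
    also have "(\<Sum>d\<in>\<dots>. ?A d) \<le> X / D1\<^sup>2 * (2 * (sqrt X / real q + 1))"
      using sum_count_cong_large_le[OF assms(1-3), of D1] assms by simp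
    finally show "sum t4 ?D \<le> X / D1\<^sup>2 * (2 * (sqrt X / real q + 1))" .
  qed
  finally show ?thesis .
qed

text \<open>For fixed \<open>e\<close>, the primes \<open>p\<close> with \<open>p * e\<close> a middle divisor and cofactor \<open>m\<close> all satisfy
  \<open>m * p\<^sup>2 \<equiv> a / e\<^sup>2\<close>; both sides being smaller than \<open>q\<close>, the integer \<open>m * p\<^sup>2\<close> does not depend
  on \<open>p\<close>, so these primes all divide one integer and there are few of them.\<close>

lemma card_primes_in_middle_divisors_le:
  assumes "prime q" "coprime a (int q)" "D0 > 0" "P1 > 0" "X * P1\<^sup>2 / D0\<^sup>2 < real q"
    "log 2 (X * P1\<^sup>2 / D0\<^sup>2) \<le> K" "K \<ge> 0"
  shows "real (card {p. prime p \<and> real p \<le> P1 \<and> p * e \<in> middle_divisors X q a D0 D1}) \<le> K"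
proof (cases "{p. prime p \<and> real p \<le> P1 \<and> p * e \<in> middle_divisors X q a D0 D1} = {}")
  case True
  then show ?thesis using assms(7) by (simp only: card.empty)
next
  case False
  let ?R = "{p. prime p \<and> real p \<le> P1 \<and> p * e \<in> middle_divisors X q a D0 D1}"
  have finR: "finite ?R"
    by (rule finite_subset[OF _ finite_real_le_nat[of "\<lambda>_. True" P1]]) auto
  \<comment> \<open>As \<open>p * e\<close> exceeds \<open>D0\<close>, its cofactor \<open>m\<close>
    is at most \<open>X / D0\<^sup>2\<close>; with \<open>p <= P1\<close> this keeps
    \<open>m * p\<^sup>2\<close> below \<open>q\<close>.\<close>
  have cof: "\<exists>m>0. real (m * p\<^sup>2) \<le> X * P1\<^sup>2 / D0\<^sup>2 \<and> [int (e\<^sup>2 * (m * p\<^sup>2)) = a] (mod int q)"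
    if p: "p \<in> ?R" for p
  proof -
    obtain m where m: "m > 0" "real ((p * e)\<^sup>2 * m) \<le> X" "[int ((p * e)\<^sup>2 * m) = a] (mod int q)"
      and D0: "D0 < real (p * e)" and P1: "real p \<le> P1"
      using p unfolding middle_divisors_def by blast
    have "D0\<^sup>2 * real m \<le> (real (p * e))\<^sup>2 * real m"
      using D0 assms by (intro mult_right_mono power_mono) auto
    also have "\<dots> \<le> X" using m(2) by simp
    finally have mX: "real m \<le> X / D0\<^sup>2" using assms by (simp add: field_simps)
    have "real (m * p\<^sup>2) \<le> X / D0\<^sup>2 * P1\<^sup>2"
      unfolding of_nat_mult of_nat_power using mX P1 order_trans[OF _ mX, of 0]
      by (intro mult_mono power_mono) auto
    then show ?thesis using m(1,3) by (intro exI[of _ m]) (auto simp: power_mult_distrib mult_ac)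
  qed
  from False obtain p0 where p0: "p0 \<in> ?R" by blast
  obtain m0 where m0: "m0 > 0" "real (m0 * p0\<^sup>2) \<le> X * P1\<^sup>2 / D0\<^sup>2"
    "[int (e\<^sup>2 * (m0 * p0\<^sup>2)) = a] (mod int q)" using cof[OF p0] by blast
  define N where "N = m0 * p0\<^sup>2"
  have "\<not> q dvd e\<^sup>2 * (m0 * p0\<^sup>2)" by (rule cong_prime_not_dvd[OF assms(1,2) m0(3)])
  then have "\<not> q dvd e" by (auto simp: power2_eq_square)
  then have cop: "coprime (int (e\<^sup>2)) (int q)"
    using prime_imp_coprime[OF assms(1), of e] by (simp add: coprime_commute)
  have N: "N > 0" "real N \<le> X * P1\<^sup>2 / D0\<^sup>2" "N < q"
    using m0 p0 assms(5) prime_gt_0_nat[of p0] unfolding N_def by (auto simp del: of_nat_mult of_nat_power)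
  have "p dvd N" if p: "p \<in> ?R" for p
  proof -
    obtain m where m: "real (m * p\<^sup>2) \<le> X * P1\<^sup>2 / D0\<^sup>2" "[int (e\<^sup>2 * (m * p\<^sup>2)) = a] (mod int q)"
      using cof[OF p] by blast
    have "real (m * p\<^sup>2) < real q" using m(1) assms(5) by linarith
    then have "m * p\<^sup>2 < q" by (simp only: of_nat_less_iff)
    have "[int (e\<^sup>2) * int (m * p\<^sup>2) = int (e\<^sup>2) * int N] (mod int q)"
      using cong_trans[OF m(2) cong_sym[OF m0(3)]] unfolding N_def by (simp only: of_nat_mult)
    then have "[int (m * p\<^sup>2) = int N] (mod int q)" using cop by (simp only: cong_mult_lcancel)
    then have "[m * p\<^sup>2 = N] (mod q)" by (simp only: cong_int_iff)
    then have "m * p\<^sup>2 = N" using \<open>m * p\<^sup>2 < q\<close> N(3) by (rule cong_less_modulus_unique_nat)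
    then show ?thesis by (auto simp: power2_eq_square)
  qed
  then have "\<Prod>?R dvd N" using finR by (intro prod_primes_dvd) auto
  then have "\<Prod>?R \<le> N" using N(1) by (rule dvd_imp_le)
  \<comment> \<open>Primes are at least 2, so the product of the primes in \<open>?R\<close>, and
    with it \<open>N\<close>, is at least \<open>2 ^ card ?R\<close>. The binary logarithm then
    bounds their number.\<close>
  moreover have "(\<Prod>p\<in>?R. 2) \<le> \<Prod>?R" by (intro prod_mono) (auto dest: prime_ge_2_nat)
  ultimately have "2 ^ card ?R \<le> N" by simp
  then have "real (2 ^ card ?R) \<le> real N" by (rule of_nat_mono)
  then have "real (2 ^ card ?R) \<le> X * P1\<^sup>2 / D0\<^sup>2" using N(2) by (rule order_trans)
  then have "2 powr real (card ?R) \<le> X * P1\<^sup>2 / D0\<^sup>2" by (simp add: powr_realpow)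
  moreover from this have "0 < X * P1\<^sup>2 / D0\<^sup>2" by (rule less_le_trans[rotated]) simp
  ultimately have "real (card ?R) \<le> log 2 (X * P1\<^sup>2 / D0\<^sup>2)" by (simp add: le_log_iff)
  then show ?thesis using assms(6) by linarith
qed

text \<open>Either \<open>d\<close> has no prime factor between \<open>P0\<close> and
  \<open>P1\<close>, or \<open>d = p * e\<close> with such a \<open>p\<close>. In the second case
  \<open>e <= D1 / P0\<close>, and each \<open>e\<close> goes with at most \<open>K\<close>
  primes.\<close>

lemma card_middle_divisors_le:
  assumes "prime q" "coprime a (int q)" "D0 > 0" "P0 > 0" "P1 > 0" "D1 \<ge> 0" "X * P1\<^sup>2 / D0\<^sup>2 < real q"
    "log 2 (X * P1\<^sup>2 / D0\<^sup>2) \<le> K" "K \<ge> 0"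
  shows "real (card (middle_divisors X q a D0 D1)) \<le>
    real (card {d\<in>squarefree_over {p. \<not> (P0 < real p \<and> real p \<le> P1)} D1. D0 < real d}) + D1 / P0 * K"
proof -
  let ?G = "middle_divisors X q a D0 D1"
  let ?S = "{d\<in>squarefree_over {p. \<not> (P0 < real p \<and> real p \<le> P1)} D1. D0 < real d}"
  let ?Es = "{e::nat. 0 < e \<and> real e \<le> D1 / P0}"
  let ?R = "\<lambda>e. {p. prime p \<and> real p \<le> P1 \<and> p * e \<in> ?G}"
  have finR: "finite (?R e)" for e
    by (rule finite_subset[OF _ finite_real_le_nat[of "\<lambda>_. True" P1]]) auto
  have finE: "finite ?Es" by (rule finite_real_le_nat)
  have sub: "?G \<subseteq> ?S \<union> (\<lambda>(e, p). p * e) ` Sigma ?Es ?R"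
  proof
    fix d assume d: "d \<in> ?G"
    show "d \<in> ?S \<union> (\<lambda>(e, p). p * e) ` Sigma ?Es ?R"
    proof (cases "\<exists>p\<in>prime_factors d. P0 < real p \<and> real p \<le> P1")
      case False
      then show ?thesis using d by (auto simp: squarefree_over_def middle_divisors_def)
    next
      case True
      then obtain p where p: "prime p" "p dvd d" "P0 < real p" "real p \<le> P1" by auto
      from p(2) obtain e where e: "d = p * e" by (auto elim: dvdE)
      have "e > 0" using d e assms(3) by (intro Nat.gr0I) (auto simp: middle_divisors_def)
      moreover have "real e \<le> D1 / P0"
      proof -
        have "real e * P0 \<le> real e * real p" using p by (intro mult_left_mono) auto
        also have "\<dots> \<le> D1" using d e by (simp add: middle_divisors_def mult.commute)
        finally show ?thesis using assms by (simp add: field_simps)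
      qed
      ultimately have "(e, p) \<in> Sigma ?Es ?R" using p d e by auto
      then show ?thesis using e by (auto intro: image_eqI[of _ _ "(e, p)"])
    qed
  qed
  have "card ?G \<le> card (?S \<union> (\<lambda>(e, p). p * e) ` Sigma ?Es ?R)"
    using finE finR by (intro card_mono[OF _ sub]) auto
  also have "\<dots> \<le> card ?S + card ((\<lambda>(e, p). p * e) ` Sigma ?Es ?R)" by (rule card_Un_le)
  also have "\<dots> \<le> card ?S + card (Sigma ?Es ?R)"
    using finE finR by (intro add_left_mono card_image_le finite_SigmaI) auto
  also have "card (Sigma ?Es ?R) = (\<Sum>e\<in>?Es. card (?R e))" using finE finR by (intro card_SigmaI) auto
  finally have "real (card ?G) \<le> real (card ?S + (\<Sum>e\<in>?Es. card (?R e)))" by (rule of_nat_mono)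
  also have "\<dots> = real (card ?S) + (\<Sum>e\<in>?Es. real (card (?R e)))" by simp
  also have "(\<Sum>e\<in>?Es. real (card (?R e))) \<le> (\<Sum>e\<in>?Es. K)"
    by (intro sum_mono card_primes_in_middle_divisors_le assms)
  also have "\<dots> = real (card ?Es) * K" by simp
  also have "\<dots> \<le> D1 / P0 * K" using assms by (intro mult_right_mono card_pos_le_real) auto
  finally show ?thesis by simp
qed

subsection \<open>Choice of parameters\<close>

text \<open>Markov's inequality: each \<open>d\<close> that is counted contributes more than
  \<open>ln D0\<close> to the sum of \<open>ln d\<close>.\<close>

lemma card_squarefree_over_le:
  assumes "D0 > 1" "D1 \<ge> 0"
  shows "real (card {d\<in>squarefree_over Q D1. D0 < real d}) \<le>
    ln 4 * D1 / ln D0 * (\<Prod>p | prime p \<and> p \<in> Q \<and> real p \<le> D1. 1 + 1 / real p)"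
proof -
  let ?S = "{d\<in>squarefree_over Q D1. D0 < real d}"
  have "real (card ?S) * ln D0 = (\<Sum>d\<in>?S. ln D0)" by simp
  also have "\<dots> \<le> (\<Sum>d\<in>?S. ln (real d))" using assms by (intro sum_mono) auto
  also have "\<dots> \<le> (\<Sum>d\<in>squarefree_over Q D1. ln (real d))"
  proof (rule sum_mono2)
    fix d assume "d \<in> squarefree_over Q D1 - ?S"
    then have "d \<noteq> 0" by (intro notI) (auto simp: squarefree_over_def)
    then show "0 \<le> ln (real d)" by simp
  qed auto
  also have "\<dots> \<le> ln 4 * D1 * (\<Prod>p | prime p \<and> p \<in> Q \<and> real p \<le> D1. 1 + 1 / real p)"
    by (rule sum_ln_squarefree_over_le) fact
  finally show ?thesis using assms by (simp add: pos_le_divide_eq)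
qed

text \<open>Primes up to \<open>P0\<close> contribute at most \<open>2 * sqrt P0\<close>. Those
  beyond \<open>P1\<close> contribute, by \<open>1 + t <= exp t\<close>, at most the exponential of
  a sum over \<open>j\<close> dyadic blocks, which reach up to \<open>D\<close>.\<close>

lemma prod_primes_outside_interval_le:
  assumes "P0 \<ge> 1" "P1 > 1" "P0 \<le> P1" "D \<le> 2 ^ j * P1"
  shows "(\<Prod>p | prime p \<and> p \<in> {p. \<not> (P0 < real p \<and> real p \<le> P1)} \<and> real p \<le> D. 1 + 1 / real p) \<le>
    2 * sqrt P0 * exp (real j * (2 * ln 4 / ln P1))"
proof -
  let ?A = "{p::nat. prime p \<and> real p \<le> P0}" and ?B = "{p::nat. prime p \<and> P1 < real p \<and> real p \<le> 2 ^ j * P1}"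
  have finA: "finite ?A" by (rule finite_real_le_nat)
  have finB: "finite ?B"
    using finite_real_le_nat[of "\<lambda>p. prime p \<and> P1 < real p" "2 ^ j * P1"] by (simp add: conj_assoc)
  have "(\<Prod>p | prime p \<and> p \<in> {p. \<not> (P0 < real p \<and> real p \<le> P1)} \<and> real p \<le> D. 1 + 1 / real p) \<le>
      (\<Prod>p\<in>?A \<union> ?B. 1 + 1 / real p)"
    using finA finB assms by (intro prod_mono2) auto
  also have "\<dots> = (\<Prod>p\<in>?A. 1 + 1 / real p) * (\<Prod>p\<in>?B. 1 + 1 / real p)"
    using finA finB assms by (intro prod.union_disjoint) auto
  also have "\<dots> \<le> (2 * sqrt P0) * exp (real j * (2 * ln 4 / ln P1))"
  proof (rule mult_mono)
    show "(\<Prod>p\<in>?A. 1 + 1 / real p) \<le> 2 * sqrt P0"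
      by (rule prod_one_plus_inverse_primes_le) fact
    have "(\<Prod>p\<in>?B. 1 + 1 / real p) \<le> (\<Prod>p\<in>?B. exp (1 / real p))"
      by (intro prod_mono conjI exp_ge_add_one_self) auto
    also have "\<dots> = exp (\<Sum>p\<in>?B. 1 / real p)" using finB by (simp add: exp_sum)
    also have "\<dots> \<le> exp (real j * (2 * ln 4 / ln P1))"
      using sum_inverse_primes_dyadic_le[OF assms(2), of j] by simp
    finally show "(\<Prod>p\<in>?B. 1 + 1 / real p) \<le> exp (real j * (2 * ln 4 / ln P1))" .
  qed (use assms in \<open>auto intro!: prod_nonneg\<close>)
  finally show ?thesis .
qed

section \<open>The estimate for large \<open>X\<close>\<close>

lemma abs_E_le_powr:
  "\<exists>C X0. C \<ge> 0 \<and> (\<forall>X q a. X \<ge> X0 \<longrightarrow> prime q \<longrightarrow> coprime a (int q) \<longrightarrow>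
    \<bar>E X q a\<bar> \<le> C * (X powr (1 / 3) / ln X powr (1 / 6) + X / (real q * ln X)))"
proof -
  define D0 :: "real \<Rightarrow> real" where "D0 = (\<lambda>X. X powr (1 / 3) / ln X powr (1 / 6))"
  \<comment> \<open>Chosen so that \<open>X / (D1 X)\<^sup>2 = D0 X\<close>, which balances the
    ranges of small and of large \<open>d\<close>.\<close>
  define D1 :: "real \<Rightarrow> real" where "D1 = (\<lambda>X. D0 X * ln X powr (1 / 4))"
  \<comment> \<open>With \<open>L = ln X\<close>, the sieve bound is of order
    \<open>D1 * sqrt P0 / L\<close>. The exponent \<open>3/2\<close> turns this into
    \<open>D0\<close>, since \<open>1/4 + 3/4 - 1 = 0\<close>, and \<open>D1 / P0 * L\<close> is
    then of lower order.\<close>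
  define P0 :: "real \<Rightarrow> real" where "P0 = (\<lambda>X. ln X powr (3 / 2))"
  \<comment> \<open>Small enough that \<open>X * P1\<^sup>2 / D0\<^sup>2\<close>, about
    \<open>X powr (5/12)\<close>, stays below \<open>sqrt X\<close>; a power of \<open>X\<close>, so
    that the primes beyond it cost only a constant factor.\<close>
  define P1 :: "real \<Rightarrow> real" where "P1 = (\<lambda>X. X powr (1 / 24))"
  have ev: "eventually (\<lambda>X. ln X \<ge> 1 \<and> D0 X > 1 \<and> X * (P1 X)\<^sup>2 / (D0 X)\<^sup>2 < sqrt X) at_top"
    "eventually (\<lambda>X. ln X / 4 \<le> ln (D0 X) \<and> D1 X \<le> sqrt X / ln X \<and> D1 X \<le> X) at_top"
    "eventually (\<lambda>X. 6 / D0 X \<le> 1 / ln X \<and> 2 * sqrt X / (D1 X)\<^sup>2 \<le> 1 / ln X \<and> P0 X \<le> P1 X) at_top"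
    unfolding D1_def D0_def P0_def P1_def by (intro eventually_conj; real_asymp)+
  then obtain X0 where X0: "\<And>X. X \<ge> X0 \<Longrightarrow>
      (ln X \<ge> 1 \<and> D0 X > 1 \<and> X * (P1 X)\<^sup>2 / (D0 X)\<^sup>2 < sqrt X) \<and>
      (ln X / 4 \<le> ln (D0 X) \<and> D1 X \<le> sqrt X / ln X \<and> D1 X \<le> X) \<and>
      (6 / D0 X \<le> 1 / ln X \<and> 2 * sqrt X / (D1 X)\<^sup>2 \<le> 1 / ln X \<and> P0 X \<le> P1 X)"
    using eventually_conj[OF ev(1) eventually_conj[OF ev(2,3)]] unfolding eventually_at_top_linorder by blast
  \<comment> \<open>\<open>8\<close> is \<open>4 * 2\<close>, from
    \<open>ln (D0 X) >= ln X / 4\<close> and from \<open>2 * sqrt (P0 X)\<close>; \<open>144\<close>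
    bounds \<open>48 * j / ln X\<close> for \<open>j <= 3 * ln X\<close>; the summand
    \<open>2\<close> stems from \<open>D1 / P0 * (2 * ln X)\<close>.\<close>
  define C1 :: real where "C1 = 8 * ln 4 * exp (144 * ln 4) + 2"
  have C1: "C1 \<ge> 0" by (simp add: C1_def)
  have main: "\<bar>E X q a\<bar> \<le> (C1 + 3) * (D0 X + X / (real q * ln X))"
    if X: "X \<ge> max X0 1" and q: "prime q" and a: "coprime a (int q)" for X q a
  proof -
    define l where "l = ln X"
    define Z where "Z = X / (real q * l)"
    have X1: "X \<ge> 1" and fl: "l \<ge> 1" and fD0: "D0 X > 1" and fP: "X * (P1 X)\<^sup>2 / (D0 X)\<^sup>2 < sqrt X"
      and flnD0: "l / 4 \<le> ln (D0 X)" and fD1: "D1 X \<le> sqrt X / l" and fD1X: "D1 X \<le> X"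
      and f6: "6 / D0 X \<le> 1 / l" and f7: "2 * sqrt X / (D1 X)\<^sup>2 \<le> 1 / l" and fP01: "P0 X \<le> P1 X"
      using X0[of X] X unfolding l_def by auto
    have q0: "real q > 0" using prime_gt_0_nat[OF q] by simp
    have Z0: "Z \<ge> 0" using X1 q0 fl by (simp add: Z_def)
    have D1_eq: "D1 X = D0 X * l powr (1 / 4)" by (simp add: D1_def l_def)
    have D01: "D0 X \<le> D1 X" unfolding D1_eq using fD0 fl by (simp add: ge_one_powr_ge_zero)
    have P0: "P0 X = l powr (3 / 2)" "P0 X \<ge> 1" using fl by (auto simp: P0_def l_def ge_one_powr_ge_zero)
    have D1sq: "X / (D1 X)\<^sup>2 = D0 X"
    proof -
      have "(D1 X)\<^sup>2 * D0 X = X powr (1 / 3 + 1 / 3 + 1 / 3) * l powr (1 / 4 + 1 / 4) /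
          l powr (1 / 6 + 1 / 6 + 1 / 6)"
        unfolding D1_eq powr_add power2_eq_square by (simp add: D0_def l_def[symmetric])
      also have "\<dots> = X" using X1 fl by simp
      finally show ?thesis using D01 fD0 by (simp add: field_simps)
    qed
    have mid: "real (card (middle_divisors X q a (D0 X) (D1 X))) \<le> C1 * D0 X + Z"
    proof (cases "real q \<le> sqrt X")
      case True
      \<comment> \<open>For \<open>q <= sqrt X\<close> the trivial count suffices, as
        \<open>D1 <= sqrt X / ln X\<close> and \<open>sqrt X <= X / q\<close>.\<close>
      have "middle_divisors X q a (D0 X) (D1 X) \<subseteq> {n. 0 < n \<and> real n \<le> D1 X}"
        using fD0 by (auto simp: middle_divisors_def intro!: Nat.gr0I)
      then have "card (middle_divisors X q a (D0 X) (D1 X)) \<le> card {n::nat. 0 < n \<and> real n \<le> D1 X}"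
        by (intro card_mono finite_real_le_nat)
      then have "real (card (middle_divisors X q a (D0 X) (D1 X))) \<le> real (card {n::nat. 0 < n \<and> real n \<le> D1 X})"
        by (rule of_nat_mono)
      also have "\<dots> \<le> D1 X" using D01 fD0 by (intro card_pos_le_real) auto
      also have "\<dots> \<le> sqrt X / l" by (rule fD1)
      also have "sqrt X \<le> X / real q"
      proof -
        have "sqrt X * real q \<le> sqrt X * sqrt X" using True X1 by (intro mult_left_mono) auto
        then show ?thesis using q0 X1 by (simp add: field_simps)
      qed
      then have "sqrt X / l \<le> Z" unfolding Z_def using fl by (simp add: divide_right_mono flip: divide_divide_eq_left)
      finally show ?thesis using C1 fD0 by (smt (verit) mult_nonneg_nonneg)
    next
      case False
      \<comment> \<open>Enough doublings that \<open>2 ^ j >= X >= D1 X\<close>, yet at most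
        \<open>3 * ln X\<close> of them, so that the primes beyond \<open>P1\<close> contribute a
        bounded factor.\<close>
      define j where "j = nat \<lceil>l / ln 2\<rceil>"
      have ln2: "ln 2 \<ge> (1 / 2 :: real)" using ln2_ge_two_thirds by simp
      have l2: "l / ln 2 \<le> 2 * l"
        using fl ln2 by (simp add: pos_divide_le_eq)
      have j1: "l / ln 2 \<le> real j" unfolding j_def by (rule real_nat_ceiling_ge)
      have j2: "real j \<le> 3 * l"
      proof -
        have "real j \<le> l / ln 2 + 1" unfolding j_def using fl by (simp add: of_nat_ceiling)
        then show ?thesis using l2 fl by linarith
      qed
      have P1: "P1 X > 1" "ln (P1 X) = l / 24"
      proof -
        have "X > 1" using fl X1 unfolding l_def by (cases "X = 1") auto
        then show "P1 X > 1" "ln (P1 X) = l / 24" by (auto simp: P1_def l_def ln_powr)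
      qed
      have "X = exp l" using X1 by (simp add: l_def)
      also have "\<dots> \<le> exp (real j * ln 2)" using j1 by (simp add: field_simps)
      also have "\<dots> = 2 ^ j" by (simp add: exp_of_nat_mult)
      finally have "X \<le> 2 ^ j" .
      moreover have "2 ^ j \<le> 2 ^ j * P1 X" using P1 by simp
      ultimately have "D1 X \<le> 2 ^ j * P1 X" using fD1X by linarith
      then have "(\<Prod>p | prime p \<and> p \<in> {p. \<not> (P0 X < real p \<and> real p \<le> P1 X)} \<and> real p \<le> D1 X.
          1 + 1 / real p) \<le> 2 * sqrt (P0 X) * exp (real j * (2 * ln 4 / ln (P1 X)))"
        using P0 P1 fP01 by (intro prod_primes_outside_interval_le) auto
      also have "\<dots> \<le> 2 * sqrt (P0 X) * exp (144 * ln 4)"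
      proof -
        have "real j * (2 * ln 4 / ln (P1 X)) = real j * (48 * ln 4 / l)" unfolding P1 by simp
        also have "\<dots> \<le> 3 * l * (48 * ln 4 / l)" using j2 fl by (intro mult_right_mono) auto
        also have "\<dots> = 144 * ln 4" using fl by simp
        finally show ?thesis using P0(2) by (intro mult_left_mono) auto
      qed
      finally have pr: "(\<Prod>p | prime p \<and> p \<in> {p. \<not> (P0 X < real p \<and> real p \<le> P1 X)} \<and> real p \<le> D1 X.
          1 + 1 / real p) \<le> 2 * sqrt (P0 X) * exp (144 * ln 4)" .
      have "real (card {d\<in>squarefree_over {p. \<not> (P0 X < real p \<and> real p \<le> P1 X)} (D1 X). D0 X < real d}) \<le>
          ln 4 * D1 X / ln (D0 X) * (\<Prod>p | prime p \<and> p \<in> {p. \<not> (P0 X < real p \<and> real p \<le> P1 X)} \<and>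
          real p \<le> D1 X. 1 + 1 / real p)"
        using fD0 D01 by (intro card_squarefree_over_le) auto
      also have "\<dots> \<le> (ln 4 * D1 X / (l / 4)) * (2 * sqrt (P0 X) * exp (144 * ln 4))"
        using fD0 D01 fl flnD0 by (intro mult_mono pr divide_left_mono) (auto intro!: prod_nonneg)
      also have "\<dots> = 8 * ln 4 * exp (144 * ln 4) * D0 X * (l powr (1 / 4) * sqrt (P0 X) / l)"
        unfolding D1_eq by simp
      also have "l powr (1 / 4) * sqrt (P0 X) / l = 1"
      proof -
        have "sqrt (P0 X) = l powr (3 / 4)" unfolding P0 using fl by (simp add: powr_half_sqrt[symmetric] powr_powr)
        then show ?thesis using fl by (simp flip: powr_add)
      qed
      finally have S: "real (card {d\<in>squarefree_over {p. \<not> (P0 X < real p \<and> real p \<le> P1 X)} (D1 X). D0 X < real d})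
          \<le> 8 * ln 4 * exp (144 * ln 4) * D0 X" by simp
      have "log 2 (X * (P1 X)\<^sup>2 / (D0 X)\<^sup>2) \<le> log 2 X"
      proof -
        have "sqrt X \<le> X" using X1 by (simp add: real_le_lsqrt power2_eq_square)
        then have "X * (P1 X)\<^sup>2 / (D0 X)\<^sup>2 \<le> X" using fP by linarith
        moreover have "0 < X * (P1 X)\<^sup>2 / (D0 X)\<^sup>2" using X1 P1 fD0 by simp
        ultimately show ?thesis using X1 by simp
      qed
      also have "\<dots> \<le> 2 * l" using l2 by (simp add: log_def l_def)
      finally have lg: "log 2 (X * (P1 X)\<^sup>2 / (D0 X)\<^sup>2) \<le> 2 * l" .
      have "D1 X / P0 X * (2 * l) \<le> 2 * D0 X"
      proof -
        have "l powr (1 / 4) * l \<le> l powr (3 / 2)"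
        proof -
          have "l powr (1 / 4) * l powr 1 \<le> l powr (3 / 2)"
            unfolding powr_add[symmetric] using fl by (intro powr_mono) auto
          then show ?thesis using fl by simp
        qed
        then have "l powr (1 / 4) * l / P0 X \<le> 1" using fl unfolding P0 by (simp add: pos_divide_le_eq)
        then have "2 * D0 X * (l powr (1 / 4) * l / P0 X) \<le> 2 * D0 X * 1" using fD0 by (intro mult_left_mono) auto
        then show ?thesis by (simp add: D1_eq mult_ac)
      qed
      moreover have "real (card (middle_divisors X q a (D0 X) (D1 X))) \<le>
          real (card {d\<in>squarefree_over {p. \<not> (P0 X < real p \<and> real p \<le> P1 X)} (D1 X). D0 X < real d}) +
          D1 X / P0 X * (2 * l)"
        using fD0 P0 P1 D01 False fP fl by (intro card_middle_divisors_le q a lg) auto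
      ultimately show ?thesis using S Z0 unfolding C1_def by (simp add: algebra_simps)
    qed
    have "6 * X / (real q * D0 X) = X / real q * (6 / D0 X)" by simp
    also have "\<dots> \<le> X / real q * (1 / l)" using X1 q0 by (intro mult_left_mono f6) auto
    finally have t2: "6 * X / (real q * D0 X) \<le> Z" by (simp add: Z_def)
    have "X / (D1 X)\<^sup>2 * (2 * (sqrt X / real q + 1)) = X / real q * (2 * sqrt X / (D1 X)\<^sup>2) + 2 * (X / (D1 X)\<^sup>2)"
      by (simp add: algebra_simps)
    also have "\<dots> \<le> X / real q * (1 / l) + 2 * D0 X"
      unfolding D1sq using X1 q0 by (intro add_mono mult_left_mono f7) auto
    finally have t4: "X / (D1 X)\<^sup>2 * (2 * (sqrt X / real q + 1)) \<le> Z + 2 * D0 X" by (simp add: Z_def)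
    have "\<bar>E X q a\<bar> \<le> D0 X + 6 * X / (real q * D0 X) + real (card (middle_divisors X q a (D0 X) (D1 X))) +
        X / (D1 X)\<^sup>2 * (2 * (sqrt X / real q + 1))"
      using X1 fD0 D01 by (intro abs_E_le q a) auto
    \<comment> \<open>\<open>D0\<close> enters once for small \<open>d\<close>, \<open>C1\<close>
      times for the middle range and twice for large \<open>d\<close>; \<open>Z\<close> enters once
      each from the density terms, the middle range and large \<open>d\<close>.\<close>
    also have "\<dots> \<le> (C1 + 3) * D0 X + 3 * Z" using t2 t4 mid by (simp add: algebra_simps)
    also have "\<dots> \<le> (C1 + 3) * D0 X + (C1 + 3) * Z" using C1 Z0 by (intro add_left_mono mult_right_mono) auto
    finally show ?thesis by (simp add: Z_def l_def distrib_left)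
  qed
  show ?thesis
    by (rule exI[of _ "C1 + 3"], rule exI[of _ "max X0 1"]) (use main C1 in \<open>auto simp: D0_def\<close>)
qed

section \<open>Bounded \<open>X\<close> and the conclusion\<close>

lemma sum_moebius_mu_square_le:
  assumes "X \<ge> 0"
  shows "(\<Sum>n | 0 < n \<and> real n \<le> X \<and> P n. real_of_int ((moebius_mu n)\<^sup>2)) \<le> X"
proof -
  let ?N = "{n. 0 < n \<and> real n \<le> X \<and> P n}"
  have "(\<Sum>n\<in>?N. real_of_int ((moebius_mu n)\<^sup>2)) \<le> (\<Sum>n\<in>?N. 1)"
    by (intro sum_mono) (simp add: moebius_mu_square)
  also have "\<dots> = real (card ?N)" by simp
  also have "\<dots> \<le> real (card {n::nat. 0 < n \<and> real n \<le> X})"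
    by (intro of_nat_mono card_mono finite_real_le_nat) auto
  also have "\<dots> \<le> X" by (rule card_pos_le_real) fact
  finally show ?thesis .
qed

text \<open>Both sums lie between 0 and \<open>X\<close> and the second has weight at most 1. This
  settles bounded \<open>X\<close>.\<close>

lemma abs_E_trivial_le:
  assumes "X \<ge> 0" "q > 0"
  shows "\<bar>E X q a\<bar> \<le> X"
proof -
  let ?A = "\<Sum>n | 0 < n \<and> real n \<le> X \<and> [int n = a] (mod int q). real_of_int ((moebius_mu n)\<^sup>2)"
  let ?B = "\<Sum>n | 0 < n \<and> real n \<le> X \<and> coprime n q. real_of_int ((moebius_mu n)\<^sup>2)"
  have A: "0 \<le> ?A" "?A \<le> X" and B: "0 \<le> ?B" "?B \<le> X"
    using assms by (auto intro!: sum_nonneg sum_moebius_mu_square_le simp del: of_int_power)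
  have "1 / real (totient q) * ?B \<le> 1 * ?B"
    using B(1) assms(2) totient_gt_0_iff[of q] by (intro mult_right_mono) (auto simp: Suc_le_eq)
  moreover have "0 \<le> 1 / real (totient q) * ?B" using B(1) by simp
  ultimately show ?thesis unfolding E_def using A B by linarith
qed

theorem theorem4:
  shows "\<forall>\<gamma>::real. 0 < \<gamma> \<and> \<gamma> < 1 / 2 \<longrightarrow>
    (\<exists>C::real. \<forall>(X::real) (q::nat) (a::int).
      X > 3 \<and> prime q \<and> coprime a (int q) \<longrightarrow>
      \<bar>E X q a\<bar> \<le> C *
        (X powr (1 / 3) * ln (ln X) powr (7 / 3) / ln X powr (1 / 6 - \<gamma> / 3)
         + X * (ln (ln X))\<^sup>2 / (real q * ln X powr (\<gamma> / 2))))"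
proof (intro allI impI)
  fix \<gamma> :: real assume \<gamma>: "0 < \<gamma> \<and> \<gamma> < 1 / 2"
  obtain C0 X0 where C0: "C0 \<ge> 0" and bound: "\<And>X q a. X \<ge> X0 \<Longrightarrow> prime q \<Longrightarrow> coprime a (int q) \<Longrightarrow>
      \<bar>E X q a\<bar> \<le> C0 * (X powr (1 / 3) / ln X powr (1 / 6) + X / (real q * ln X))"
    using abs_E_le_powr by blast
  \<comment> \<open>Beyond \<open>exp (exp 1)\<close> one has \<open>ln (ln X) >= 1\<close>, so the
    powers of \<open>ln (ln X)\<close> in the claim only enlarge the right-hand side.\<close>
  define X1 where "X1 = max X0 (exp (exp 1))"
  \<comment> \<open>A lower bound for the first term of the claim when \<open>3 < X < X1\<close>,
    positive because \<open>ln 3 > 1\<close>. In that range the error is at most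
    \<open>X1 = X1 / c * c\<close>.\<close>
  define c where "c = ln (ln 3) powr (7 / 3) / ln X1 powr (1 / 6 - \<gamma> / 3)"
  have ln3: "ln (3::real) > 1"
    by (rule ln3_gt_1)
  have lnX1: "ln X1 \<ge> exp 1"
    using ln_le_cancel_iff[of "exp (exp 1)" X1] unfolding X1_def by (smt (verit) exp_gt_zero ln_exp)
  then have lnX1_pos: "ln X1 > 0" using exp_gt_zero[of "1::real"] by linarith
  have c: "c > 0" unfolding c_def using ln3 lnX1_pos by (intro divide_pos_pos) auto
  show "\<exists>C::real. \<forall>(X::real) (q::nat) (a::int).
      X > 3 \<and> prime q \<and> coprime a (int q) \<longrightarrow>
      \<bar>E X q a\<bar> \<le> C *
        (X powr (1 / 3) * ln (ln X) powr (7 / 3) / ln X powr (1 / 6 - \<gamma> / 3)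
         + X * (ln (ln X))\<^sup>2 / (real q * ln X powr (\<gamma> / 2)))"
  proof (intro exI[of _ "C0 + X1 / c"] allI impI)
    fix X :: real and q :: nat and a :: int
    assume *: "X > 3 \<and> prime q \<and> coprime a (int q)"
    define F where "F = X powr (1 / 3) * ln (ln X) powr (7 / 3) / ln X powr (1 / 6 - \<gamma> / 3)"
    define S where "S = X * (ln (ln X))\<^sup>2 / (real q * ln X powr (\<gamma> / 2))"
    have q: "real q > 0" using * prime_gt_0_nat by auto
    have lnX: "ln X > ln 3" using * by simp
    then have "ln X > 1" using ln3 by linarith
    note lnX = lnX this
    have F0: "F \<ge> 0" and S0: "S \<ge> 0" unfolding F_def S_def using * q by auto
    have X1: "X1 > 0" unfolding X1_def by (smt (verit) exp_gt_zero)
    show "\<bar>E X q a\<bar> \<le> (C0 + X1 / c) * (F + S)"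
    proof (cases "X \<ge> X1")
      case True
      have "ln X \<ge> exp 1" using True lnX1 X1 by (smt (verit) ln_le_cancel_iff)
      then have ll: "ln (ln X) \<ge> 1" using ln_ge_iff[of "ln X" 1] lnX by simp
      have "X powr (1 / 3) / ln X powr (1 / 6) \<le> F"
        unfolding F_def
      proof (rule frac_le)
        show "ln X powr (1 / 6 - \<gamma> / 3) \<le> ln X powr (1 / 6)" using lnX \<gamma> by (intro powr_mono) auto
        have "ln (ln X) powr (7 / 3) \<ge> 1" using ll by (simp add: ge_one_powr_ge_zero)
        then show "X powr (1 / 3) \<le> X powr (1 / 3) * ln (ln X) powr (7 / 3)"
          by (simp add: mult_le_cancel_left1)
      qed (use lnX in auto)
      moreover have "X / (real q * ln X) \<le> S"
        unfolding S_def
      proof (rule frac_le)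
        have "ln X powr (\<gamma> / 2) \<le> ln X powr 1" using lnX \<gamma> by (intro powr_mono) auto
        then show "real q * ln X powr (\<gamma> / 2) \<le> real q * ln X" using q lnX by simp
        have "(ln (ln X))\<^sup>2 \<ge> 1" using ll by (simp add: one_le_power)
        then show "X \<le> X * (ln (ln X))\<^sup>2" using * by (simp add: mult_le_cancel_left1)
      qed (use lnX q * in auto)
      ultimately have "C0 * (X powr (1 / 3) / ln X powr (1 / 6) + X / (real q * ln X)) \<le> C0 * (F + S)"
        using C0 by (intro mult_left_mono add_mono)
      moreover have "\<bar>E X q a\<bar> \<le> C0 * (X powr (1 / 3) / ln X powr (1 / 6) + X / (real q * ln X))"
        using * True by (intro bound) (auto simp: X1_def)
      moreover have "0 \<le> X1 / c * (F + S)" using F0 S0 X1 c by simp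
      ultimately show ?thesis by (simp add: distrib_right)
    next
      case False
      have "c \<le> F"
      proof -
        have "ln X \<le> ln X1" using False * by simp
        \<comment> \<open>\<open>\<gamma> < 1 / 2\<close> makes the exponent positive, so the power
          increases with its base.\<close>
        then have d: "ln X powr (1 / 6 - \<gamma> / 3) \<le> ln X1 powr (1 / 6 - \<gamma> / 3)"
          using lnX \<gamma> by (intro powr_mono2) auto
        have "ln (ln 3) \<le> ln (ln X)" using lnX ln3 by simp
        then have "ln (ln 3) powr (7 / 3) \<le> ln (ln X) powr (7 / 3)" using ln3 by (intro powr_mono2) auto
        also have "\<dots> \<le> X powr (1 / 3) * ln (ln X) powr (7 / 3)"
          using * ge_one_powr_ge_zero[of X "1 / 3"] by (simp add: mult_le_cancel_right1)
        finally show ?thesis unfolding c_def F_def using d lnX by (intro frac_le) auto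
      qed
      have "\<bar>E X q a\<bar> \<le> X" using * prime_gt_0_nat by (intro abs_E_trivial_le) auto
      also have "\<dots> \<le> X1 / c * c" using False c by simp
      also have "\<dots> \<le> X1 / c * (F + S)" using \<open>c \<le> F\<close> S0 X1 c by (intro mult_left_mono) auto
      also have "\<dots> \<le> (C0 + X1 / c) * (F + S)" using C0 F0 S0 by (intro mult_right_mono) auto
      finally show ?thesis .
    qed
  qed
qed

end
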